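(* Let $\mathbf{x}_1,\dots,\mathbf{x}_n\in\mathbb{R}^p$, $\mathbf{y}\in\{-1,1\}^n$, let $\mathcal{P}=\{i:y_i=1\}$ and $\mathcal{N}=\{j:y_j=-1\}$ both be nonempty, $m=|\mathcal{P}||\mathcal{N}|$, and $\mu>0$. Let $$F(\mathbf{w})=\max_{\boldsymbol\beta\in[-1,1]^{\mathcal{P}\times\mathcal{N}}}\Big(\frac1m\sum_{i\in\mathcal{P},j\in\mathcal{N}}\beta_{ij}\mathbf{w}^\top(\mathbf{x}_i-\mathbf{x}_j)-\frac1{2m}\sum_{i\in\mathcal{P},j\in\mathcal{N}}\beta_{ij}-\frac{\mu}{2}\sum_{i\in\mathcal{P},j\in\mathcal{N}}\beta_{ij}^2\Big),\qquad\mathbf{w}\in\mathbb{R}^p .$$ Then $F$ is differentiable with $$\nabla F(\mathbf{w})=\frac1m\Big[\sum_{i\in\mathcal{P}}\gamma_i\mathbf{x}_i-\sum_{j\in\mathcal{N}}\gamma_j\mathbf{x}_j\Big],\qquad \gamma_i=\sum_{j\in\mathcal{N}}\beta^*_{ij}\ (i\in\mathcal{P}),\quad \gamma_j=\sum_{i\in\mathcal{P}}\beta^*_{ij}\ (j\in\mathcal{N}),$$ where $\beta^*_{ij}=\mathrm{median}(1,\,a_i-a_j,\,-1)$, $a_i=\frac1{\mu m}(\mathbf{w}^\top\mathbf{x}_i-\frac14)$ for $i\in\mathcal{P}$ and $a_j=\frac1{\mu m}(\mathbf{w}^\top\mathbf{x}_j+\frac14)$ for $j\in\mathcal{N}$.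 Moreover, given the values $a_1,\dots,a_n$, all the numbers $\gamma_i$ ($i\in\mathcal{P}$) and $\gamma_j$ ($j\in\mathcal{N}$) can be computed in $O(n\log n)$ time, and given these the gradient can be computed in $O(np)$ time.
   Context: $F$ is the smoothed ROCArea empirical risk (up to an additive constant). Running time is measured in the real-arithmetic model (unit-cost arithmetic operations and comparisons). *)

theory Defs
  imports
    "HOL-Analysis.Derivative"
    "Jordan_Normal_Form.Matrix"
begin

(* From here on, the bullet is scalar_prod of Jordan_Normal_Form, not the
   type-class inner product. *)
unbundle no inner_syntax

section \<open>Gradients on real vectors of explicit dimension\<close>

text \<open>
  The dimension p is quantified inside the statement (an algorithm has to be uniform in it),
  so vectors are taken from \<^term>\<open>carrier_vec p\<close> rather than from a type of fixed dimension.
  This type carries no norm, hence the explicit Frechet condition; lemma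
  \<open>has_gradient_iff_gderiv\<close> identifies it with the type-class notion.
\<close>

definition vnorm :: "real vec \<Rightarrow> real" where
  "vnorm h = sqrt (h \<bullet> h)"

definition has_gradient :: "nat \<Rightarrow> (real vec \<Rightarrow> real) \<Rightarrow> real vec \<Rightarrow> real vec \<Rightarrow> bool" where
  "has_gradient p F g w \<longleftrightarrow> g \<in> carrier_vec p \<and>
     (\<forall>e>0. \<exists>d>0. \<forall>h\<in>carrier_vec p. vnorm h < d \<longrightarrow>
        \<bar>F (w + h) - F w - g \<bullet> h\<bar> \<le> e * vnorm h)"

lemma has_gradient_iff_gderiv:
  fixes b :: "nat \<Rightarrow> 'a::euclidean_space" and v g :: 'a
  assumes b: "bij_betw b {..<DIM('a)} Basis"
  defines "coords \<equiv> (\<lambda>u::'a. vec DIM('a) (\<lambda>k. inner u (b k)))"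
  shows "has_gradient DIM('a) F (coords g) (coords v) \<longleftrightarrow> GDERIV (\<lambda>u. F (coords u)) v :> g"
proof -
  have ip: "coords u \<bullet> coords u' = inner u u'" for u u'
  proof -
    have "inner u u' = (\<Sum>i\<in>Basis. inner u i * inner u' i)"
      by (rule euclidean_inner)
    also have "\<dots> = (\<Sum>k<DIM('a). inner u (b k) * inner u' (b k))"
      using sum.reindex_bij_betw[OF b, of "\<lambda>i. inner u i * inner u' i"] by simp
    also have "\<dots> = coords u \<bullet> coords u'"
      by (simp add: coords_def scalar_prod_def lessThan_atLeast0)
    finally show ?thesis ..
  qed
  have nrm: "vnorm (coords u) = norm u" for u
    by (simp add: vnorm_def ip norm_eq_sqrt_inner)
  have add: "coords (u + u') = coords u + coords u'" for u u'
    by (rule eq_vecI) (auto simp: coords_def inner_add_left)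
  have carr: "coords u \<in> carrier_vec DIM('a)" for u
    by (simp add: coords_def)
  have surj: "\<exists>u. h = coords u" if h: "h \<in> carrier_vec DIM('a)" for h
  proof -
    define u where "u = (\<Sum>k<DIM('a). (h $ k) *\<^sub>R b k)"
    have "inner u (b l) = h $ l" if l: "l < DIM('a)" for l
    proof -
      have "inner (b k) (b l) = (if k = l then 1 else 0)" if "k < DIM('a)" for k
      proof -
        have "b k \<in> Basis" "b l \<in> Basis"
          using bij_betwE[OF b] that l by auto
        moreover have "b k = b l \<longleftrightarrow> k = l"
          using bij_betw_imp_inj_on[OF b] that l by (simp add: inj_on_eq_iff)
        ultimately show ?thesis by (simp add: inner_Basis)
      qed
      then have "(\<Sum>k<DIM('a). h $ k * inner (b k) (b l)) = (\<Sum>k<DIM('a). if k = l then h $ k else 0)"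
        by (intro sum.cong) auto
      then have "inner u (b l) = (\<Sum>k<DIM('a). if k = l then h $ k else 0)"
        by (simp add: u_def inner_sum_left)
      then show ?thesis using l by simp
    qed
    then have "h = coords u"
      using h by (intro eq_vecI) (auto simp: coords_def)
    then show ?thesis ..
  qed
  have "has_gradient DIM('a) F (coords g) (coords v) \<longleftrightarrow>
     (\<forall>e>0. \<exists>d>0. \<forall>h\<in>range coords. vnorm h < d \<longrightarrow>
        \<bar>F (coords v + h) - F (coords v) - coords g \<bullet> h\<bar> \<le> e * vnorm h)"
  proof -
    have "range coords = carrier_vec DIM('a)" using carr surj by blast
    then show ?thesis by (simp add: has_gradient_def carr)
  qed
  also have "\<dots> \<longleftrightarrow> (\<forall>e>0. \<exists>d>0. \<forall>u. norm u < d \<longrightarrow>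
        \<bar>F (coords (v + u)) - F (coords v) - inner g u\<bar> \<le> e * norm u)"
    by (simp only: ball_simps nrm add ip)
  also have "\<dots> \<longleftrightarrow> (\<forall>e>0. \<exists>d>0. \<forall>u. norm (u - v) < d \<longrightarrow>
        \<bar>F (coords u) - F (coords v) - inner (u - v) g\<bar> \<le> e * norm (u - v))"
  proof -
    have shift: "(\<forall>u. P u) \<longleftrightarrow> (\<forall>u. P (u - v))" for P :: "'a \<Rightarrow> bool"
    proof
      assume r: "\<forall>u. P (u - v)"
      show "\<forall>u. P u"
      proof
        fix u show "P u" using r[rule_format, of "u + v"] by simp
      qed
    qed simp
    show ?thesis
      by (subst shift) (simp add: inner_commute)
  qed
  also have "\<dots> \<longleftrightarrow> GDERIV (\<lambda>u. F (coords u)) v :> g"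
    unfolding gderiv_def has_derivative_at_alt
    by (simp add: bounded_linear_inner_left real_norm_def)
  finally show ?thesis .
qed


section \<open>The smoothed ROCArea risk\<close>

text \<open>Indices run over 0..n-1 instead of 1..n.\<close>

definition pos_set :: "real vec \<Rightarrow> nat set" where
  "pos_set y = {i. i < dim_vec y \<and> y $ i = 1}"

definition neg_set :: "real vec \<Rightarrow> nat set" where
  "neg_set y = {j. j < dim_vec y \<and> y $ j = -1}"

definition npairs :: "real vec \<Rightarrow> nat" where
  "npairs y = card (pos_set y) * card (neg_set y)"

definition roc_data ::
  "nat \<Rightarrow> nat \<Rightarrow> (nat \<Rightarrow> real vec) \<Rightarrow> real vec \<Rightarrow> real \<Rightarrow> bool" where
  "roc_data n p x y \<mu> \<longleftrightarrow>
     (\<forall>i<n. x i \<in> carrier_vec p) \<and>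
     y \<in> carrier_vec n \<and> (\<forall>i<n. y $ i \<in> {-1, 1}) \<and>
     pos_set y \<noteq> {} \<and> neg_set y \<noteq> {} \<and> \<mu> > 0"

definition roc_objective ::
  "(nat \<Rightarrow> real vec) \<Rightarrow> real vec \<Rightarrow> real \<Rightarrow> real vec \<Rightarrow> (nat \<times> nat \<Rightarrow> real) \<Rightarrow> real" where
  "roc_objective x y \<mu> w \<beta> =
     1 / real (npairs y) * (\<Sum>i\<in>pos_set y. \<Sum>j\<in>neg_set y. \<beta> (i, j) * (w \<bullet> (x i - x j)))
     - 1 / (2 * real (npairs y)) * (\<Sum>i\<in>pos_set y. \<Sum>j\<in>neg_set y. \<beta> (i, j))
     - \<mu> / 2 * (\<Sum>i\<in>pos_set y. \<Sum>j\<in>neg_set y. (\<beta> (i, j))\<^sup>2)"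

definition dual_box :: "real vec \<Rightarrow> (nat \<times> nat \<Rightarrow> real) set" where
  "dual_box y = (pos_set y \<times> neg_set y) \<rightarrow>\<^sub>E {-1..1}"

text \<open>The supremum is a maximum, see \<open>roc_risk_is_max\<close> below.\<close>

definition roc_risk ::
  "(nat \<Rightarrow> real vec) \<Rightarrow> real vec \<Rightarrow> real \<Rightarrow> real vec \<Rightarrow> real" where
  "roc_risk x y \<mu> w = (SUP \<beta>\<in>dual_box y. roc_objective x y \<mu> w \<beta>)"

definition median3 :: "real \<Rightarrow> real \<Rightarrow> real \<Rightarrow> real" where
  "median3 a b c = sort [a, b, c] ! 1"

definition a_val ::
  "(nat \<Rightarrow> real vec) \<Rightarrow> real vec \<Rightarrow> real \<Rightarrow> real vec \<Rightarrow> nat \<Rightarrow> real" where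
  "a_val x y \<mu> w i = 1 / (\<mu> * real (npairs y)) *
     (if i \<in> pos_set y then w \<bullet> x i - 1/4 else w \<bullet> x i + 1/4)"

definition beta_star ::
  "(nat \<Rightarrow> real vec) \<Rightarrow> real vec \<Rightarrow> real \<Rightarrow> real vec \<Rightarrow> nat \<Rightarrow> nat \<Rightarrow> real" where
  "beta_star x y \<mu> w i j = median3 1 (a_val x y \<mu> w i - a_val x y \<mu> w j) (-1)"

definition roc_gamma ::
  "(nat \<Rightarrow> real vec) \<Rightarrow> real vec \<Rightarrow> real \<Rightarrow> real vec \<Rightarrow> nat \<Rightarrow> real" where
  "roc_gamma x y \<mu> w k =
     (if k \<in> pos_set y then \<Sum>j\<in>neg_set y. beta_star x y \<mu> w k j
      else \<Sum>i\<in>pos_set y. beta_star x y \<mu> w i k)"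

definition roc_grad ::
  "nat \<Rightarrow> (nat \<Rightarrow> real vec) \<Rightarrow> real vec \<Rightarrow> real \<Rightarrow> real vec \<Rightarrow> real vec" where
  "roc_grad p x y \<mu> w = vec p (\<lambda>k. 1 / real (npairs y) *
     ((\<Sum>i\<in>pos_set y. roc_gamma x y \<mu> w i * x i $ k)
      - (\<Sum>j\<in>neg_set y. roc_gamma x y \<mu> w j * x j $ k)))"

lemma roc_risk_is_max:
  "(\<exists>\<beta>\<in>dual_box y. roc_risk x y \<mu> w = roc_objective x y \<mu> w \<beta>) \<and>
   (\<forall>\<beta>\<in>dual_box y. roc_objective x y \<mu> w \<beta> \<le> roc_risk x y \<mu> w)"
proof -
  define c where "c = (\<lambda>i j. 1 / real (npairs y) * (w \<bullet> (x i - x j)) - 1 / (2 * real (npairs y)))"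
  define q where "q = (\<lambda>i j t. c i j * t - \<mu> / 2 * t\<^sup>2)"
  have obj: "roc_objective x y \<mu> w \<beta> = (\<Sum>i\<in>pos_set y. \<Sum>j\<in>neg_set y. q i j (\<beta> (i, j)))" for \<beta>
    unfolding roc_objective_def q_def c_def sum_distrib_left sum_subtractf[symmetric]
    by (intro sum.cong refl) (simp add: algebra_simps)
  have "\<exists>t\<in>{-1..1}. \<forall>s\<in>{-1..1}. q i j s \<le> q i j t" for i j
    by (rule continuous_attains_sup) (auto simp: q_def intro!: continuous_intros)
  then have "\<forall>i j. \<exists>t. t \<in> {-1..1} \<and> (\<forall>s\<in>{-1..1}. q i j s \<le> q i j t)" by blast
  then obtain t where t': "\<forall>i j. t i j \<in> {-1..1} \<and> (\<forall>s\<in>{-1..1}. q i j s \<le> q i j (t i j))"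
    unfolding choice_iff by blast
  then have t: "t i j \<in> {-1..1}" "s \<in> {-1..1} \<Longrightarrow> q i j s \<le> q i j (t i j)" for i j s
    by blast+
  define \<beta>0 where "\<beta>0 = restrict (\<lambda>(i, j). t i j) (pos_set y \<times> neg_set y)"
  have mem: "\<beta>0 \<in> dual_box y"
    unfolding \<beta>0_def dual_box_def restrict_PiE_iff split_beta by (intro ballI t(1))
  have le: "roc_objective x y \<mu> w \<beta> \<le> roc_objective x y \<mu> w \<beta>0" if "\<beta> \<in> dual_box y" for \<beta>
    unfolding obj
  proof (intro sum_mono)
    fix i j assume ij: "i \<in> pos_set y" "j \<in> neg_set y"
    then have "\<beta> (i, j) \<in> {-1..1}"
      using PiE_mem[OF that[unfolded dual_box_def], of "(i, j)"] by blast
    then show "q i j (\<beta> (i, j)) \<le> q i j (\<beta>0 (i, j))"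
      using t(2)[of "\<beta> (i, j)" i j] ij by (simp add: \<beta>0_def)
  qed
  then have "roc_risk x y \<mu> w = roc_objective x y \<mu> w \<beta>0"
    unfolding roc_risk_def using mem by (intro cSup_eq_maximum) auto
  with mem le show ?thesis by auto
qed


section \<open>The real-arithmetic machine model\<close>

text \<open>
  Structured programs for a real RAM. A program uses finitely many named registers and arrays
  holding reals, and likewise for natural numbers, which serve as array indices and loop
  counters. Every instruction and every evaluation of a test costs one unit. The program is
  fixed before the input, so it is uniform in all problem sizes. Restrictions that keep unit
  cost meaningful: index arithmetic is limited to addition and (truncated) subtraction, real
  constants are integers, and reals can be turned into indices only through comparisons.
  Division by zero yields zero; this saves a program no more than one comparison.
\<close>

type_synonym name = string

record ram_state =
  ireg :: "name \<Rightarrow> nat"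
  rreg :: "name \<Rightarrow> real"
  iarr :: "name \<Rightarrow> nat \<Rightarrow> nat"
  rarr :: "name \<Rightarrow> nat \<Rightarrow> real"

datatype instr =
    IConst name nat
  | IMove name name
  | IAdd name name name
  | ISub name name name
  | ILoad name name name
  | IStore name name name
  | RConst name int
  | RMove name name
  | RAdd name name name
  | RSub name name name
  | RMul name name name
  | RDiv name name name
  | RLoad name name name
  | RStore name name name

text \<open>In loads and stores, \<open>A\<close> names an array and \<open>i\<close> the index register addressing it.\<close>

fun exec_instr :: "instr \<Rightarrow> ram_state \<Rightarrow> ram_state" where
  "exec_instr (IConst d k) s = s\<lparr>ireg := (ireg s)(d := k)\<rparr>"
| "exec_instr (IMove d a) s = s\<lparr>ireg := (ireg s)(d := ireg s a)\<rparr>"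
| "exec_instr (IAdd d a b) s = s\<lparr>ireg := (ireg s)(d := ireg s a + ireg s b)\<rparr>"
| "exec_instr (ISub d a b) s = s\<lparr>ireg := (ireg s)(d := ireg s a - ireg s b)\<rparr>"
| "exec_instr (ILoad d A i) s = s\<lparr>ireg := (ireg s)(d := iarr s A (ireg s i))\<rparr>"
| "exec_instr (IStore A i a) s =
     s\<lparr>iarr := (iarr s)(A := (iarr s A)(ireg s i := ireg s a))\<rparr>"
| "exec_instr (RConst d k) s = s\<lparr>rreg := (rreg s)(d := of_int k)\<rparr>"
| "exec_instr (RMove d a) s = s\<lparr>rreg := (rreg s)(d := rreg s a)\<rparr>"
| "exec_instr (RAdd d a b) s = s\<lparr>rreg := (rreg s)(d := rreg s a + rreg s b)\<rparr>"
| "exec_instr (RSub d a b) s = s\<lparr>rreg := (rreg s)(d := rreg s a - rreg s b)\<rparr>"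
| "exec_instr (RMul d a b) s = s\<lparr>rreg := (rreg s)(d := rreg s a * rreg s b)\<rparr>"
| "exec_instr (RDiv d a b) s = s\<lparr>rreg := (rreg s)(d := rreg s a / rreg s b)\<rparr>"
| "exec_instr (RLoad d A i) s = s\<lparr>rreg := (rreg s)(d := rarr s A (ireg s i))\<rparr>"
| "exec_instr (RStore A i a) s =
     s\<lparr>rarr := (rarr s)(A := (rarr s A)(ireg s i := rreg s a))\<rparr>"

datatype test =
    ILess name name
  | ILeq name name
  | RLess name name
  | RLeq name name

fun eval_test :: "test \<Rightarrow> ram_state \<Rightarrow> bool" where
  "eval_test (ILess a b) s \<longleftrightarrow> ireg s a < ireg s b"
| "eval_test (ILeq a b) s \<longleftrightarrow> ireg s a \<le> ireg s b"
| "eval_test (RLess a b) s \<longleftrightarrow> rreg s a < rreg s b"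
| "eval_test (RLeq a b) s \<longleftrightarrow> rreg s a \<le> rreg s b"

datatype com =
    Skip
  | Instr instr
  | Seq com com
  | If test com com
  | While test com

text \<open>\<open>exec c s t s'\<close>: started in \<open>s\<close>, \<open>c\<close> halts in \<open>s'\<close> after \<open>t\<close> time units.\<close>

inductive exec :: "com \<Rightarrow> ram_state \<Rightarrow> nat \<Rightarrow> ram_state \<Rightarrow> bool" where
  Skip: "exec Skip s 1 s"
| Instr: "exec (Instr a) s 1 (exec_instr a s)"
| Seq: "exec c1 s t1 s' \<Longrightarrow> exec c2 s' t2 s'' \<Longrightarrow> exec (Seq c1 c2) s (t1 + t2) s''"
| IfTrue: "eval_test b s \<Longrightarrow> exec c1 s t s' \<Longrightarrow> exec (If b c1 c2) s (1 + t) s'"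
| IfFalse: "\<not> eval_test b s \<Longrightarrow> exec c2 s t s' \<Longrightarrow> exec (If b c1 c2) s (1 + t) s'"
| WhileFalse: "\<not> eval_test b s \<Longrightarrow> exec (While b c) s 1 s"
| WhileTrue: "eval_test b s \<Longrightarrow> exec c s t1 s' \<Longrightarrow> exec (While b c) s' t2 s'' \<Longrightarrow>
    exec (While b c) s (1 + t1 + t2) s''"

lemma exec_deterministic:
  assumes "exec c s t s'" and "exec c s u s''"
  shows "u = t \<and> s'' = s'"
  using assms
proof (induction arbitrary: u s'' rule: exec.induct)
  case (Skip s)
  from Skip.prems show ?case by cases simp_all
next
  case (Instr a s)
  from Instr.prems show ?case by cases simp_all
next
  case (Seq c1 s t1 s1 c2 t2 s2)
  from Seq.prems obtain u1 r u2 where "exec c1 s u1 r" "exec c2 r u2 s''" "u = u1 + u2"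
    by cases
  with Seq.IH(1)[of u1 r] Seq.IH(2)[of u2 s''] show ?case by simp
next
  case (IfTrue b s c1 t s1 c2)
  from IfTrue.prems IfTrue.hyps(1) obtain u1 where "exec c1 s u1 s''" "u = 1 + u1"
    by cases auto
  with IfTrue.IH[of u1 s''] show ?case by simp
next
  case (IfFalse b s c2 t s1 c1)
  from IfFalse.prems IfFalse.hyps(1) obtain u1 where "exec c2 s u1 s''" "u = 1 + u1"
    by cases auto
  with IfFalse.IH[of u1 s''] show ?case by simp
next
  case (WhileFalse b s c)
  from WhileFalse.prems WhileFalse.hyps show ?case by cases simp_all
next
  case (WhileTrue b s c t1 s1 t2 s2)
  from WhileTrue.prems WhileTrue.hyps(1) obtain u1 r u2
    where "exec c s u1 r" "exec (While b c) r u2 s''" "u = 1 + u1 + u2"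
    by cases auto
  with WhileTrue.IH(1)[of u1 r] WhileTrue.IH(2)[of u2 s''] show ?case by simp
qed

definition halts_within :: "com \<Rightarrow> ram_state \<Rightarrow> real \<Rightarrow> (ram_state \<Rightarrow> bool) \<Rightarrow> bool" where
  "halts_within c s T Q \<longleftrightarrow> (\<exists>t s'. exec c s t s' \<and> real t \<le> T \<and> Q s')"

text \<open>
  Input conventions. Nothing is assumed about registers, arrays and array cells that are not
  mentioned. The data matrix is stored row by row.
\<close>

definition gamma_input :: "nat \<Rightarrow> real vec \<Rightarrow> (nat \<Rightarrow> real) \<Rightarrow> ram_state \<Rightarrow> bool" where
  "gamma_input n y a s \<longleftrightarrow> ireg s ''n'' = n \<and>
     (\<forall>i<n. rarr s ''y'' i = y $ i) \<and> (\<forall>i<n. rarr s ''a'' i = a i)"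

definition grad_input ::
  "nat \<Rightarrow> nat \<Rightarrow> (nat \<Rightarrow> real vec) \<Rightarrow> real vec \<Rightarrow> (nat \<Rightarrow> real) \<Rightarrow> ram_state \<Rightarrow> bool" where
  "grad_input n p x y \<gamma> s \<longleftrightarrow> ireg s ''n'' = n \<and> ireg s ''p'' = p \<and>
     (\<forall>i<n. rarr s ''y'' i = y $ i) \<and>
     (\<forall>i<n. \<forall>k<p. rarr s ''x'' (i * p + k) = x i $ k) \<and>
     (\<forall>i<n. rarr s ''gamma'' i = \<gamma> i)"

end

theory Submission
  imports Defs
begin

text \<open>
  The maximisation separates over pairs into one-dimensional concave quadratic problems on
  \<open>[-1, 1]\<close>, each maximised by clipping \<open>a i - a j\<close>. So the risk is a sum of Huber-type functions
  of affine functions; comparing the maximisers at \<open>w\<close> and \<open>w + h\<close> bounds the first-order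
  remainder by a multiple of \<open>(vnorm h)\<^sup>2\<close>.

  For the algorithm, \<open>\<gamma> k\<close> is half the sum of \<open>(y k - y l) * clip (a k - a l)\<close> over all \<open>l\<close>, since
  the first factor vanishes within a class, and \<open>clip t = max (t + 1) 0 - max (t - 1) 0 - 1\<close>.
  Once the indices are merge-sorted by \<open>a\<close>, the elements with \<open>a l < a k + c\<close> form a
  prefix growing with \<open>a k\<close>, so for \<open>c = 1\<close> and \<open>c = -1\<close> a linear two-pointer sweep maintaining four
  prefix sums yields all positive-part sums.
\<close>

unbundle no vec_syntax

section \<open>Differentiability\<close>

text \<open>The time bounds carry no additive term: at n = 1 or p = 0 they would be 0, although
  every run costs at least one unit. So all lower-order costs are absorbed through n >= 2, which
  holds because both classes are nonempty, and p >= 1. The machine shapes the programs. There are no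
  procedures and indices are only added and subtracted, hence a bottom-up merge sort whose block
  width doubles by self-addition, and a column of the data matrix is visited with stride p. An index
  never becomes a real, so the real value of n is counted up. The label factor in the formula for
  gamma lets one sort and two sweeps serve both classes without case distinctions; the half cancels
  the factor 2 of \<open>y k - y l\<close> across classes. The same device merges the two sums of
  the gradient into one. Elements lying exactly at a threshold contribute 0 to a positive part, so
  ties in \<open>a\<close> are harmless and the sort is free to break them either way.\<close>

definition clip :: "real \<Rightarrow> real" where
  "clip t = max (-1) (min 1 t)"

lemma median3_eq_clip: "median3 1 t (-1) = clip t"
  by (simp add: median3_def clip_def)

lemma beta_star_eq_clip:
  "beta_star x y \<mu> w i j = clip (a_val x y \<mu> w i - a_val x y \<mu> w j)"
  by (simp add: beta_star_def median3_eq_clip)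

lemma clip_bounds: "clip t \<in> {-1..1}"
  by (simp add: clip_def)

lemma clip_minus: "clip (- t) = - clip t"
  by (simp add: clip_def)

lemma clip_eq_diff_pos_parts: "clip t = max (t + 1) 0 - max (t - 1) 0 - 1"
  by (simp add: clip_def max_def min_def)

text \<open>This is the Huber function: t^2/2 on [-1, 1] and |t| - 1/2 outside. It is written as the
  value of the one-pair objective at its maximiser, which makes comparisons between maximisers plain
  algebra.\<close>

definition huber :: "real \<Rightarrow> real" where
  "huber t = t * clip t - (clip t)\<^sup>2 / 2"

text \<open>Completing the square turns the left side into t^2/2 minus half of (t - s)^2, and
  \<open>clip t\<close> is the point of [-1, 1] nearest to \<open>t\<close>.\<close>

lemma le_huber:
  assumes "s \<in> {-1..1}"
  shows "t * s - s\<^sup>2 / 2 \<le> huber t"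
proof -
  have "(t - clip t)\<^sup>2 \<le> (t - s)\<^sup>2"
    using assms unfolding abs_le_square_iff[symmetric] by (auto simp: clip_def max_def min_def abs_if)
  then show ?thesis by (simp add: huber_def power2_eq_square algebra_simps)
qed

lemma clip_lipschitz: "\<bar>clip s - clip t\<bar> \<le> \<bar>s - t\<bar>"
  by (auto simp: clip_def)

text \<open>Both bounds are the envelope argument: the maximiser at one point is feasible at the other.\<close>

lemma huber_remainder:
  "0 \<le> huber (t + d) - huber t - d * clip t"
  "huber (t + d) - huber t - d * clip t \<le> d\<^sup>2"
proof -
  show "0 \<le> huber (t + d) - huber t - d * clip t"
    using le_huber[OF clip_bounds, of "t + d" t] by (simp add: huber_def algebra_simps)
  have "t * clip (t + d) - (clip (t + d))\<^sup>2 / 2 \<le> huber t"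
    by (rule le_huber[OF clip_bounds])
  then have "huber (t + d) - huber t - d * clip t \<le> d * (clip (t + d) - clip t)"
    by (simp add: huber_def algebra_simps)
  also have "\<dots> \<le> \<bar>d\<bar> * \<bar>clip (t + d) - clip t\<bar>"
    by (metis abs_ge_self abs_mult)
  also have "\<dots> \<le> \<bar>d\<bar> * \<bar>d\<bar>"
    using clip_lipschitz[of "t + d" t] by (intro mult_left_mono) auto
  finally show "huber (t + d) - huber t - d * clip t \<le> d\<^sup>2"
    by (simp add: power2_eq_square)
qed

section \<open>Reduction of the risk to Huber functions of score differences\<close>

lemma finite_pos_set [simp]: "finite (pos_set y)"
  by (simp add: pos_set_def)

lemma finite_neg_set [simp]: "finite (neg_set y)"
  by (simp add: neg_set_def)

lemma neg_set_notin_pos_set: "j \<in> neg_set y \<Longrightarrow> j \<notin> pos_set y"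
  by (simp add: pos_set_def neg_set_def)

lemma roc_data_index:
  assumes "roc_data n p x y \<mu>"
  shows "i \<in> pos_set y \<Longrightarrow> i < n" "i \<in> neg_set y \<Longrightarrow> i < n"
  using assms by (auto simp: roc_data_def pos_set_def neg_set_def)

lemma npairs_pos:
  assumes "roc_data n p x y \<mu>"
  shows "npairs y > 0"
  using assms by (auto simp: npairs_def roc_data_def card_gt_0_iff)

text \<open>The offsets 1/4 of opposite sign add up to the 1/2 of the linear penalty, and the
  scaling by 1/(\<mu> m) divides out the quadratic weight. Hence the coefficient of a dual variable
  is \<mu> times a score difference, and each pair problem is \<mu> times the one solved by
  \<open>clip\<close>.\<close>

lemma npairs_a_val_diff:
  assumes d: "roc_data n p x y \<mu>" and w: "w \<in> carrier_vec p"
    and i: "i \<in> pos_set y" and j: "j \<in> neg_set y"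
  shows "\<mu> * (a_val x y \<mu> w i - a_val x y \<mu> w j)
     = 1 / real (npairs y) * (w \<bullet> (x i - x j)) - 1 / (2 * real (npairs y))"
proof -
  have "x i \<in> carrier_vec p" "x j \<in> carrier_vec p"
    using roc_data_index[OF d] i j d by (auto simp: roc_data_def)
  then have "w \<bullet> (x i - x j) = w \<bullet> x i - w \<bullet> x j"
    using w by (simp add: scalar_prod_minus_distrib)
  moreover have "\<mu> * (1 / (\<mu> * real (npairs y))) = 1 / real (npairs y)"
    using d npairs_pos[OF d] by (simp add: roc_data_def)
  moreover have "a_val x y \<mu> w i - a_val x y \<mu> w j
      = 1 / (\<mu> * real (npairs y)) * (w \<bullet> x i - w \<bullet> x j - 1/2)"
    using i neg_set_notin_pos_set[OF j] unfolding a_val_def by (simp add: algebra_simps)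
  ultimately have "\<mu> * (a_val x y \<mu> w i - a_val x y \<mu> w j)
      = 1 / real (npairs y) * (w \<bullet> (x i - x j) - 1/2)"
    by (metis mult.assoc)
  then show ?thesis by (simp add: algebra_simps)
qed

lemma roc_objective_eq:
  assumes d: "roc_data n p x y \<mu>" and w: "w \<in> carrier_vec p"
  shows "roc_objective x y \<mu> w \<beta> = (\<Sum>i\<in>pos_set y. \<Sum>j\<in>neg_set y.
     \<mu> * ((a_val x y \<mu> w i - a_val x y \<mu> w j) * \<beta> (i, j) - (\<beta> (i, j))\<^sup>2 / 2))"
proof -
  have "roc_objective x y \<mu> w \<beta> = (\<Sum>i\<in>pos_set y. \<Sum>j\<in>neg_set y.
     (1 / real (npairs y) * (w \<bullet> (x i - x j)) - 1 / (2 * real (npairs y))) * \<beta> (i, j)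
      - \<mu> / 2 * (\<beta> (i, j))\<^sup>2)"
    unfolding roc_objective_def sum_distrib_left sum_subtractf[symmetric]
    by (intro sum.cong refl) (simp add: algebra_simps)
  also have "\<dots> = (\<Sum>i\<in>pos_set y. \<Sum>j\<in>neg_set y.
     \<mu> * (a_val x y \<mu> w i - a_val x y \<mu> w j) * \<beta> (i, j) - \<mu> / 2 * (\<beta> (i, j))\<^sup>2)"
    by (intro sum.cong refl) (simp only: npairs_a_val_diff[OF d w])
  finally show ?thesis by (simp add: algebra_simps)
qed

lemma roc_risk_eq_huber:
  assumes d: "roc_data n p x y \<mu>" and w: "w \<in> carrier_vec p"
  shows "roc_risk x y \<mu> w = (\<Sum>i\<in>pos_set y. \<Sum>j\<in>neg_set y.
     \<mu> * huber (a_val x y \<mu> w i - a_val x y \<mu> w j))"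
proof -
  let ?a = "a_val x y \<mu> w"
  have "\<mu> \<ge> 0" using d by (simp add: roc_data_def)
  define \<beta>0 where "\<beta>0 = restrict (\<lambda>(i, j). clip (?a i - ?a j)) (pos_set y \<times> neg_set y)"
  have mem: "\<beta>0 \<in> dual_box y"
    unfolding \<beta>0_def dual_box_def restrict_PiE_iff split_beta by (intro ballI clip_bounds)
  have obj0: "roc_objective x y \<mu> w \<beta>0
      = (\<Sum>i\<in>pos_set y. \<Sum>j\<in>neg_set y. \<mu> * huber (?a i - ?a j))"
    unfolding roc_objective_eq[OF d w] by (intro sum.cong refl) (simp add: \<beta>0_def huber_def)
  have "roc_objective x y \<mu> w \<beta> \<le> roc_objective x y \<mu> w \<beta>0" if "\<beta> \<in> dual_box y" for \<beta>
    unfolding obj0 unfolding roc_objective_eq[OF d w]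
  proof (intro sum_mono mult_left_mono le_huber \<open>\<mu> \<ge> 0\<close>)
    fix i j assume "i \<in> pos_set y" "j \<in> neg_set y"
    then show "\<beta> (i, j) \<in> {-1..1}"
      using PiE_mem[OF that[unfolded dual_box_def], of "(i, j)"] by blast
  qed
  then have "roc_risk x y \<mu> w = roc_objective x y \<mu> w \<beta>0"
    unfolding roc_risk_def using mem by (intro cSup_eq_maximum) auto
  then show ?thesis by (simp only: obj0)
qed

lemma a_val_add:
  assumes d: "roc_data n p x y \<mu>" and w: "w \<in> carrier_vec p" and h: "h \<in> carrier_vec p"
    and i: "i < n"
  shows "a_val x y \<mu> (w + h) i = a_val x y \<mu> w i + 1 / (\<mu> * real (npairs y)) * (h \<bullet> x i)"
proof -
  have "x i \<in> carrier_vec p" using d i by (simp add: roc_data_def)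
  then have "(w + h) \<bullet> x i = w \<bullet> x i + h \<bullet> x i"
    using w h by (simp add: add_scalar_prod_distrib)
  then show ?thesis by (simp add: a_val_def ring_distribs add_divide_distrib diff_divide_distrib)
qed

text \<open>Each \<open>roc_gamma\<close> aggregates \<open>beta_star\<close> over the opposite
  class. Undoing this aggregation gives the first-order term as a sum over pairs, so that it can be
  matched with the Huber remainders pair by pair.\<close>

lemma roc_grad_scalar_prod:
  assumes d: "roc_data n p x y \<mu>" and h: "h \<in> carrier_vec p"
  shows "roc_grad p x y \<mu> w \<bullet> h = (\<Sum>i\<in>pos_set y. \<Sum>j\<in>neg_set y.
     1 / real (npairs y) * (h \<bullet> x i - h \<bullet> x j) * beta_star x y \<mu> w i j)"
proof -
  let ?g = "roc_gamma x y \<mu> w" and ?m = "1 / real (npairs y)"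
  have sp: "h \<bullet> x i = (\<Sum>k<p. x i $ k * h $ k)" if "i < n" for i
    using that d h by (auto simp: scalar_prod_def roc_data_def lessThan_atLeast0 mult.commute
        intro!: sum.cong)
  have swap: "(\<Sum>k<p. (\<Sum>i\<in>S. ?g i * x i $ k) * h $ k) = (\<Sum>i\<in>S. ?g i * (h \<bullet> x i))"
    if "\<And>i. i \<in> S \<Longrightarrow> i < n" for S
  proof -
    have "(\<Sum>k<p. (\<Sum>i\<in>S. ?g i * x i $ k) * h $ k) = (\<Sum>i\<in>S. \<Sum>k<p. ?g i * x i $ k * h $ k)"
      by (subst sum.swap) (simp add: sum_distrib_right)
    also have "\<dots> = (\<Sum>i\<in>S. ?g i * (h \<bullet> x i))"
      by (intro sum.cong refl) (simp add: sp that sum_distrib_left mult.assoc)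
    finally show ?thesis .
  qed
  have "roc_grad p x y \<mu> w \<bullet> h = (\<Sum>k<p. ?m *
     ((\<Sum>i\<in>pos_set y. ?g i * x i $ k) - (\<Sum>j\<in>neg_set y. ?g j * x j $ k)) * h $ k)"
    using h by (simp add: roc_grad_def scalar_prod_def lessThan_atLeast0)
  also have "\<dots> = ?m * ((\<Sum>k<p. (\<Sum>i\<in>pos_set y. ?g i * x i $ k) * h $ k)
      - (\<Sum>k<p. (\<Sum>j\<in>neg_set y. ?g j * x j $ k) * h $ k))"
    by (simp only: sum_subtractf[symmetric] sum_distrib_left left_diff_distrib mult.assoc)
  also have "\<dots> = ?m * ((\<Sum>i\<in>pos_set y. ?g i * (h \<bullet> x i)) - (\<Sum>j\<in>neg_set y. ?g j * (h \<bullet> x j)))"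
    by (simp only: swap roc_data_index[OF d])
  also have "(\<Sum>i\<in>pos_set y. ?g i * (h \<bullet> x i))
      = (\<Sum>i\<in>pos_set y. \<Sum>j\<in>neg_set y. beta_star x y \<mu> w i j * (h \<bullet> x i))"
    by (intro sum.cong refl) (simp add: roc_gamma_def sum_distrib_right)
  also have "(\<Sum>j\<in>neg_set y. ?g j * (h \<bullet> x j))
      = (\<Sum>j\<in>neg_set y. \<Sum>i\<in>pos_set y. beta_star x y \<mu> w i j * (h \<bullet> x j))"
    by (intro sum.cong refl) (simp add: roc_gamma_def sum_distrib_right neg_set_notin_pos_set)
  also have "\<dots> = (\<Sum>i\<in>pos_set y. \<Sum>j\<in>neg_set y. beta_star x y \<mu> w i j * (h \<bullet> x j))"
    by (rule sum.swap)
  finally show ?thesis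
    by (simp only: sum_subtractf[symmetric] sum_distrib_left)
      (simp add: algebra_simps)
qed

section \<open>Gradient from a quadratic remainder bound\<close>

lemma vnorm_sq: "(vnorm h)\<^sup>2 = h \<bullet> h"
proof -
  have "h \<bullet> h \<ge> 0" by (simp add: scalar_prod_def sum_nonneg)
  then show ?thesis by (simp add: vnorm_def)
qed

lemma vnorm_nonneg [simp]: "0 \<le> vnorm h"
  by (simp add: vnorm_def scalar_prod_def sum_nonneg)

lemma scalar_prod_sq_le:
  fixes u v :: "real vec"
  assumes "u \<in> carrier_vec p" "v \<in> carrier_vec p"
  shows "(u \<bullet> v)\<^sup>2 \<le> (u \<bullet> u) * (vnorm v)\<^sup>2"
  unfolding vnorm_sq
  using Cauchy_Schwarz_ineq_sum[of "\<lambda>i. u $ i" "\<lambda>i. v $ i" "{0..<p}"] assms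
  by (simp add: scalar_prod_def power2_eq_square)

lemma has_gradientI_quadratic:
  assumes g: "g \<in> carrier_vec p" and K: "K \<ge> 0"
    and bound: "\<And>h. h \<in> carrier_vec p \<Longrightarrow> \<bar>F (w + h) - F w - g \<bullet> h\<bar> \<le> K * (vnorm h)\<^sup>2"
  shows "has_gradient p F g w"
  unfolding has_gradient_def
proof (intro conjI allI impI g)
  fix e :: real assume "e > 0"
  show "\<exists>d>0. \<forall>h\<in>carrier_vec p. vnorm h < d \<longrightarrow> \<bar>F (w + h) - F w - g \<bullet> h\<bar> \<le> e * vnorm h"
  \<comment> \<open>\<open>K + 1\<close> rather than \<open>K\<close>, because \<open>K\<close> may
    be 0.\<close>
  proof (intro exI[of _ "e / (K + 1)"] conjI ballI impI)
    show "e / (K + 1) > 0" using \<open>e > 0\<close> K by simp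
    fix h :: "real vec" assume h: "h \<in> carrier_vec p" and small: "vnorm h < e / (K + 1)"
    have "K * vnorm h \<le> (K + 1) * vnorm h" by (intro mult_right_mono) auto
    also have "\<dots> \<le> e" using small K by (simp add: field_simps)
    finally have "K * vnorm h * vnorm h \<le> e * vnorm h" by (intro mult_right_mono) auto
    with bound[OF h] show "\<bar>F (w + h) - F w - g \<bullet> h\<bar> \<le> e * vnorm h"
      by (simp add: power2_eq_square)
  qed
qed

lemma roc_risk_has_gradient:
  assumes d: "roc_data n p x y \<mu>" and w: "w \<in> carrier_vec p"
  shows "has_gradient p (roc_risk x y \<mu>) (roc_grad p x y \<mu> w) w"
proof -
  define M where "M = 1 / (\<mu> * real (npairs y))"
  have pos: "\<mu> > 0" "npairs y > 0" using d npairs_pos[OF d] by (auto simp: roc_data_def)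
  then have M: "\<mu> * M = 1 / real (npairs y)" by (simp add: M_def)
  define v where "v i j = x i - x j" for i j
  \<comment> \<open>A step \<open>h\<close> moves the argument of a pair by M times the product of
    \<open>v i j\<close> with \<open>h\<close>. The Huber remainder is at most the square of this,
    and Cauchy-Schwarz splits off \<open>(vnorm h)\<^sup>2\<close>; \<open>K\<close> is what is
    left, summed over the pairs.\<close>
  define K where "K = (\<Sum>i\<in>pos_set y. \<Sum>j\<in>neg_set y. \<mu> * (M\<^sup>2 * (v i j \<bullet> v i j)))"
  let ?a = "a_val x y \<mu> w"
  show ?thesis
  proof (rule has_gradientI_quadratic)
    show "roc_grad p x y \<mu> w \<in> carrier_vec p" by (simp add: roc_grad_def)
    show "K \<ge> 0"
      unfolding K_def using pos by (intro sum_nonneg mult_nonneg_nonneg) (auto simp: scalar_prod_def sum_nonneg)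
    fix h :: "real vec" assume h: "h \<in> carrier_vec p"
    define \<delta> where "\<delta> i j = M * (h \<bullet> x i - h \<bullet> x j)" for i j
    define R where "R i j = huber (?a i - ?a j + \<delta> i j) - huber (?a i - ?a j)
        - \<delta> i j * clip (?a i - ?a j)" for i j
    have wh: "w + h \<in> carrier_vec p" using w h by simp
    have risk: "roc_risk x y \<mu> (w + h)
       = (\<Sum>i\<in>pos_set y. \<Sum>j\<in>neg_set y. \<mu> * huber (?a i - ?a j + \<delta> i j))"
      unfolding roc_risk_eq_huber[OF d wh]
      by (intro sum.cong refl)
        (simp add: a_val_add[OF d w h] roc_data_index[OF d] \<delta>_def M_def algebra_simps)
    have grad: "roc_grad p x y \<mu> w \<bullet> h
       = (\<Sum>i\<in>pos_set y. \<Sum>j\<in>neg_set y. \<mu> * (\<delta> i j * clip (?a i - ?a j)))"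
      unfolding roc_grad_scalar_prod[OF d h] M[symmetric]
      by (intro sum.cong refl) (simp add: \<delta>_def beta_star_eq_clip)
    have eq: "roc_risk x y \<mu> (w + h) - roc_risk x y \<mu> w - roc_grad p x y \<mu> w \<bullet> h
       = (\<Sum>i\<in>pos_set y. \<Sum>j\<in>neg_set y. \<mu> * R i j)"
      unfolding risk grad roc_risk_eq_huber[OF d w] sum_subtractf[symmetric]
      by (simp add: R_def algebra_simps)
    have \<delta>: "(\<delta> i j)\<^sup>2 \<le> M\<^sup>2 * (v i j \<bullet> v i j) * (vnorm h)\<^sup>2" if "i \<in> pos_set y" "j \<in> neg_set y" for i j
    proof -
      have x: "x i \<in> carrier_vec p" "x j \<in> carrier_vec p"
        using roc_data_index[OF d] that d by (auto simp: roc_data_def)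
      then have v: "v i j \<in> carrier_vec p" by (simp add: v_def)
      have "\<delta> i j = M * (v i j \<bullet> h)"
        using x h by (simp add: \<delta>_def v_def minus_scalar_prod_distrib comm_scalar_prod[of h p])
      then show ?thesis
        using scalar_prod_sq_le[OF v h] by (simp add: power_mult_distrib mult_left_mono mult.assoc)
    qed
    \<comment> \<open>The remainder is nonnegative, which is the gradient inequality of a convex
      function. So the absolute value reduces to the upper bound.\<close>
    have "0 \<le> (\<Sum>i\<in>pos_set y. \<Sum>j\<in>neg_set y. \<mu> * R i j)"
      using pos huber_remainder(1) by (intro sum_nonneg mult_nonneg_nonneg) (auto simp: R_def)
    moreover have "(\<Sum>i\<in>pos_set y. \<Sum>j\<in>neg_set y. \<mu> * R i j)
       \<le> (\<Sum>i\<in>pos_set y. \<Sum>j\<in>neg_set y. \<mu> * (M\<^sup>2 * (v i j \<bullet> v i j) * (vnorm h)\<^sup>2))"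
    proof (intro sum_mono mult_left_mono)
      fix i j assume ij: "i \<in> pos_set y" "j \<in> neg_set y"
      show "R i j \<le> M\<^sup>2 * (v i j \<bullet> v i j) * (vnorm h)\<^sup>2"
        unfolding R_def by (rule order_trans[OF huber_remainder(2) \<delta>[OF ij]])
    qed (use pos in simp)
    moreover have "\<dots> = K * (vnorm h)\<^sup>2"
      unfolding K_def sum_distrib_right by (simp add: mult.assoc)
    ultimately show "\<bar>roc_risk x y \<mu> (w + h) - roc_risk x y \<mu> w - roc_grad p x y \<mu> w \<bullet> h\<bar>
        \<le> K * (vnorm h)\<^sup>2"
      unfolding eq by linarith
  qed
qed

section \<open>Total correctness with time bounds\<close>

text \<open>Loop-free code can be run symbolically by the simplifier through \<open>sem\<close>,
  with \<open>cost\<close> as an upper bound on its time; invariants are then required for loops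
  alone.\<close>

fun loop_free :: "com \<Rightarrow> bool" where
  "loop_free Skip \<longleftrightarrow> True"
| "loop_free (Instr a) \<longleftrightarrow> True"
| "loop_free (Seq c d) \<longleftrightarrow> loop_free c \<and> loop_free d"
| "loop_free (If b c d) \<longleftrightarrow> loop_free c \<and> loop_free d"
| "loop_free (While b c) \<longleftrightarrow> False"

text \<open>Both functions are meaningful on loop-free programs only; their values on loops are junk.\<close>

fun sem :: "com \<Rightarrow> ram_state \<Rightarrow> ram_state" where
  "sem Skip s = s"
| "sem (Instr a) s = exec_instr a s"
| "sem (Seq c d) s = sem d (sem c s)"
| "sem (If b c d) s = (if eval_test b s then sem c s else sem d s)"
| "sem (While b c) s = s"

fun cost :: "com \<Rightarrow> nat" where
  "cost Skip = 1"
| "cost (Instr a) = 1"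
| "cost (Seq c d) = cost c + cost d"
| "cost (If b c d) = 1 + max (cost c) (cost d)"
| "cost (While b c) = 1"

lemma exec_loop_free:
  assumes "loop_free c"
  shows "\<exists>t\<le>cost c. exec c s t (sem c s)"
  using assms
proof (induction c arbitrary: s)
  case Skip
  show ?case using exec.Skip[of s] by (intro exI[of _ 1]) simp
next
  case (Instr a)
  show ?case using exec.Instr[of a s] by (intro exI[of _ 1]) simp
next
  case (Seq c d)
  then obtain t u where "t \<le> cost c" "exec c s t (sem c s)"
      "u \<le> cost d" "exec d (sem c s) u (sem d (sem c s))"
    by (meson loop_free.simps(3))
  then show ?case by (intro exI[of _ "t + u"]) (auto intro: exec.Seq)
next
  case (If b c d)
  then obtain t u where "t \<le> cost c" "exec c s t (sem c s)" "u \<le> cost d" "exec d s u (sem d s)"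
    by (meson loop_free.simps(4))
  show ?case
  proof (cases "eval_test b s")
    case True
    with exec.IfTrue[OF this \<open>exec c s t (sem c s)\<close>, of d] \<open>t \<le> cost c\<close> show ?thesis
      by (intro exI[of _ "1 + t"]) simp
  next
    case False
    with exec.IfFalse[OF this \<open>exec d s u (sem d s)\<close>, of c] \<open>u \<le> cost d\<close> show ?thesis
      by (intro exI[of _ "1 + u"]) simp
  qed
qed simp

text \<open>Step counts stay natural numbers throughout the program proofs; real bounds appear only
  when the logarithm enters.\<close>

abbreviation halts :: "com \<Rightarrow> ram_state \<Rightarrow> nat \<Rightarrow> (ram_state \<Rightarrow> bool) \<Rightarrow> bool" where
  "halts c s T Q \<equiv> halts_within c s (real T) Q"

lemma halts_mono:
  assumes "halts c s T Q" "T \<le> T'" "\<And>s'. Q s' \<Longrightarrow> Q' s'"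
  shows "halts c s T' Q'"
  using assms unfolding halts_within_def by (meson of_nat_mono order_trans)

lemma halts_loop_free:
  assumes "loop_free c" "cost c \<le> T" "Q (sem c s)"
  shows "halts c s T Q"
  using exec_loop_free[OF assms(1), of s] assms(2,3) unfolding halts_within_def
  by (meson of_nat_mono order_trans)

lemma halts_Seq:
  assumes "halts c s T1 R" "\<And>s'. R s' \<Longrightarrow> halts d s' T2 Q" "T1 + T2 \<le> T"
  shows "halts (Seq c d) s T Q"
proof -
  obtain t s' where 1: "exec c s t s'" "t \<le> T1" "R s'"
    using assms(1) unfolding halts_within_def by auto
  obtain u s'' where 2: "exec d s' u s''" "u \<le> T2" "Q s''"
    using assms(2)[OF 1(3)] unfolding halts_within_def by auto
  show ?thesis
    unfolding halts_within_def
    using exec.Seq[OF 1(1) 2(1)] 1 2 assms(3) by (intro exI[of _ "t + u"] exI[of _ s'']) auto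
qed

text \<open>The potential \<open>V\<close> pays for the remaining iterations, so it also witnesses termination.\<close>

lemma halts_While:
  assumes body: "\<And>s. I s \<Longrightarrow> eval_test b s \<Longrightarrow>
      halts c s (T s) (\<lambda>s'. I s' \<and> V s' + T s + 1 \<le> V s)"
    and "I s" and "V s + 1 \<le> T'" and "\<And>s. I s \<Longrightarrow> \<not> eval_test b s \<Longrightarrow> Q s"
  shows "halts (While b c) s T' Q"
proof -
  have "\<exists>t s'. exec (While b c) s t s' \<and> t \<le> V s + 1 \<and> Q s'"
    using \<open>I s\<close>
  proof (induction "V s" arbitrary: s rule: less_induct)
    case less
    show ?case
    proof (cases "eval_test b s")
      case True
      obtain t s' where 1: "exec c s t s'" "t \<le> T s" "I s'" "V s' + T s + 1 \<le> V s"
        using body[OF less.prems True] unfolding halts_within_def by auto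
      obtain u s'' where 2: "exec (While b c) s' u s''" "u \<le> V s' + 1" "Q s''"
        using less.hyps[of s'] 1(3,4) by auto
      show ?thesis
        using exec.WhileTrue[OF True 1(1) 2(1)] 1 2
        by (intro exI[of _ "1 + t + u"] exI[of _ s'']) auto
    next
      case False
      then show ?thesis using assms(4)[OF less.prems False] exec.WhileFalse[OF False]
        by (intro exI[of _ 1] exI[of _ s]) auto
    qed
  qed
  then obtain t s' where "exec (While b c) s t s'" "t \<le> V s + 1" "Q s'" by blast
  moreover have "real t \<le> real T'" using assms(3) \<open>t \<le> V s + 1\<close> by linarith
  ultimately show ?thesis unfolding halts_within_def by blast
qed

abbreviation seq_infix (infixr ";;" 55) where "c ;; d \<equiv> Seq c d"

text \<open>The closing \<open>Skip\<close> costs a unit as well, so a block of k instructions is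
  charged k + 1. This is where budgets such as 2 for a single assignment come from.\<close>

primrec instrs :: "instr list \<Rightarrow> com" where
  "instrs [] = Skip"
| "instrs (a # as) = Seq (Instr a) (instrs as)"

lemma loop_free_instrs [simp]: "loop_free (instrs as)"
  by (induction as) auto

lemma cost_instrs [simp]: "cost (instrs as) = length as + 1"
  by (induction as) auto

lemma sem_instrs [simp]: "sem (instrs as) s = fold exec_instr as s"
  by (induction as arbitrary: s) auto

text \<open>The frame shared by the sorting, counting and sweeping loops. \<open>a\<close> and
  \<open>y\<close> are whole functions, cells beyond \<open>n\<close> included, because these arrays
  are only read. The constants sit in registers since arithmetic instructions take no
  literals.\<close>

definition env :: "nat \<Rightarrow> (nat \<Rightarrow> real) \<Rightarrow> (nat \<Rightarrow> real) \<Rightarrow> ram_state \<Rightarrow> bool" where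
  "env n a y s \<longleftrightarrow> ireg s ''n'' = n \<and> ireg s ''one'' = 1 \<and>
     rarr s ''a'' = a \<and> rarr s ''y'' = y \<and> rreg s ''one'' = 1 \<and> rreg s ''two'' = 2"

section \<open>Merge sort\<close>

text \<open>\<open>f\<close> is the source, \<open>g\<close> the target with initial contents
  \<open>g0\<close>; \<open>i\<close> and \<open>j\<close> are the read heads, \<open>k\<close> is
  the write head. Cells below \<open>lo\<close> hold blocks merged earlier in the same pass. Images
  stand in for permutations: multiplicities are recovered at the end by counting, see
  \<open>sum_permuted\<close>.\<close>

definition merge_inv :: "(nat \<Rightarrow> real) \<Rightarrow> (nat \<Rightarrow> nat) \<Rightarrow> (nat \<Rightarrow> nat) \<Rightarrow> (nat \<Rightarrow> nat) \<Rightarrow>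
    nat \<Rightarrow> nat \<Rightarrow> nat \<Rightarrow> nat \<Rightarrow> nat \<Rightarrow> nat \<Rightarrow> bool" where
  "merge_inv a f g0 g lo mid hi i j k \<longleftrightarrow>
     lo \<le> i \<and> i \<le> mid \<and> mid \<le> j \<and> j \<le> hi \<and> k + mid = i + j \<and>
     (\<forall>q<lo. g q = g0 q) \<and>
     g ` {lo..<k} = f ` ({lo..<i} \<union> {mid..<j}) \<and>
     mono_on {lo..<k} (a \<circ> g) \<and>
     (\<forall>q\<in>{lo..<k}. \<forall>r\<in>{i..<mid} \<union> {j..<hi}. a (g q) \<le> a (f r))"

lemma merge_inv_init:
  assumes "lo \<le> mid" "mid \<le> hi"
  shows "merge_inv a f g g lo mid hi lo mid lo"
  using assms by (auto simp: merge_inv_def intro: mono_onI)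

lemma mono_on_snoc:
  fixes h :: "nat \<Rightarrow> real"
  assumes "mono_on {lo..<k} h" "\<And>q. q \<in> {lo..<k} \<Longrightarrow> h q \<le> v"
  shows "mono_on {lo..<Suc k} (h(k := v))"
  using assms by (auto simp: monotone_on_def less_Suc_eq)

text \<open>The common core of both moves: all that matters is that \<open>v\<close> is an unread
  index with smallest key and that exactly one head has moved past it; which one is left
  open.\<close>

lemma merge_inv_step:
  assumes inv: "merge_inv a f g0 g lo mid hi i j k"
    and v: "\<And>r. r \<in> {i..<mid} \<union> {j..<hi} \<Longrightarrow> a v \<le> a (f r)"
    and v': "v \<in> f ` ({i..<mid} \<union> {j..<hi})"
    and step: "i \<le> i'" "i' \<le> mid" "j \<le> j'" "j' \<le> hi" "i' + j' = Suc (i + j)"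
      "insert v (f ` ({lo..<i} \<union> {mid..<j})) = f ` ({lo..<i'} \<union> {mid..<j'})"
  shows "merge_inv a f g0 (g(k := v)) lo mid hi i' j' (Suc k)"
proof -
  have inv': "lo \<le> i" "i \<le> mid" "mid \<le> j" "j \<le> hi" "k + mid = i + j"
      "\<And>q. q < lo \<Longrightarrow> g q = g0 q" "g ` {lo..<k} = f ` ({lo..<i} \<union> {mid..<j})"
      "mono_on {lo..<k} (a \<circ> g)"
      "\<And>q r. q \<in> {lo..<k} \<Longrightarrow> r \<in> {i..<mid} \<union> {j..<hi} \<Longrightarrow> a (g q) \<le> a (f r)"
    using inv unfolding merge_inv_def by auto
  have k: "lo \<le> k" using inv' by linarith
  have "{lo..<k} \<inter> {q. q \<noteq> k} = {lo..<k}" by auto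
  then have img: "(g(k := v)) ` {lo..<Suc k} = f ` ({lo..<i'} \<union> {mid..<j'})"
    unfolding step(6)[symmetric] inv'(7)[symmetric] atLeastLessThanSuc using k by simp
  have "mono_on {lo..<Suc k} ((a \<circ> g)(k := a v))"
    using inv'(8,9) v' by (intro mono_on_snoc) auto
  moreover have "(a \<circ> g)(k := a v) = a \<circ> g(k := v)" by auto
  ultimately have mono: "mono_on {lo..<Suc k} (a \<circ> g(k := v))" by simp
  have le: "a ((g(k := v)) q) \<le> a (f r)"
    if q: "q \<in> {lo..<Suc k}" and r: "r \<in> {i'..<mid} \<union> {j'..<hi}" for q r
  proof -
    have "r \<in> {i..<mid} \<union> {j..<hi}" using r step by auto
    then show ?thesis using q inv'(9)[of q r] v[of r] by (cases "q = k") auto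
  qed
  show ?thesis
    unfolding merge_inv_def using img mono le inv' step k by auto
qed

text \<open>The head of a sorted run has the smallest key of that run, so comparing the two heads
  decides the minimum of everything unread. With the right run exhausted there is nothing to
  compare, hence the guard \<open>j < hi\<close>.\<close>

lemma merge_inv_left:
  assumes inv: "merge_inv a f g0 g lo mid hi i j k"
    and mono: "mono_on {lo..<mid} (a \<circ> f)" "mono_on {mid..<hi} (a \<circ> f)"
    and i: "i < mid" and le: "j < hi \<Longrightarrow> a (f i) \<le> a (f j)"
  shows "merge_inv a f g0 (g(k := f i)) lo mid hi (Suc i) j (Suc k)"
proof -
  have b: "lo \<le> i" "mid \<le> j" "j \<le> hi" using inv by (auto simp: merge_inv_def)
  have "a (f i) \<le> a (f r)" if "r \<in> {i..<mid} \<union> {j..<hi}" for r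
  proof (cases "r \<in> {i..<mid}")
    case True
    then show ?thesis using mono_onD[OF mono(1), of i r] b by auto
  next
    case False
    then have "j \<le> r" "r < hi" using that by auto
    then show ?thesis using mono_onD[OF mono(2), of j r] le b by auto
  qed
  then show ?thesis
    using b i by (intro merge_inv_step[OF inv]) (auto simp: atLeastLessThanSuc)
qed

lemma merge_inv_right:
  assumes inv: "merge_inv a f g0 g lo mid hi i j k"
    and mono: "mono_on {lo..<mid} (a \<circ> f)" "mono_on {mid..<hi} (a \<circ> f)"
    and j: "j < hi" and le: "i < mid \<Longrightarrow> a (f j) \<le> a (f i)"
  shows "merge_inv a f g0 (g(k := f j)) lo mid hi i (Suc j) (Suc k)"
proof -
  have b: "lo \<le> i" "i \<le> mid" "mid \<le> j" using inv by (auto simp: merge_inv_def)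
  have "a (f j) \<le> a (f r)" if "r \<in> {i..<mid} \<union> {j..<hi}" for r
  proof (cases "r \<in> {j..<hi}")
    case True
    then show ?thesis using mono_onD[OF mono(2), of j r] b by auto
  next
    case False
    then have "i \<le> r" "r < mid" using that by auto
    then show ?thesis using mono_onD[OF mono(1), of i r] le b by auto
  qed
  then show ?thesis
    using b j by (intro merge_inv_step[OF inv]) (auto simp: atLeastLessThanSuc)
qed

definition take_left :: com where
  "take_left = instrs [IStore ''tmp'' ''k'' ''u'', IAdd ''i'' ''i'' ''one'']"

definition take_right :: com where
  "take_right = instrs [IStore ''tmp'' ''k'' ''v'', IAdd ''j'' ''j'' ''one'']"

text \<open>Both heads are loaded before the bounds tests. A load past the end of a run yields some
  value, as arrays are total, but the tests ensure that it is never stored.\<close>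

definition merge_body :: com where
  "merge_body =
     instrs [ILoad ''u'' ''idx'' ''i'', ILoad ''v'' ''idx'' ''j'',
       RLoad ''x'' ''a'' ''u'', RLoad ''z'' ''a'' ''v''] ;;
     If (ILess ''i'' ''mid'')
       (If (ILess ''j'' ''hi'') (If (RLeq ''x'' ''z'') take_left take_right) take_left)
       take_right ;;
     instrs [IAdd ''k'' ''k'' ''one'']"

definition merge_state :: "nat \<Rightarrow> (nat \<Rightarrow> real) \<Rightarrow> (nat \<Rightarrow> real) \<Rightarrow> (nat \<Rightarrow> nat) \<Rightarrow>
    nat \<Rightarrow> nat \<Rightarrow> nat \<Rightarrow> nat \<Rightarrow> ram_state \<Rightarrow> bool" where
  "merge_state n a y f w lo mid hi s \<longleftrightarrow> env n a y s \<and> iarr s ''idx'' = f \<and>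
     ireg s ''w'' = w \<and> ireg s ''lo'' = lo \<and> ireg s ''mid'' = mid \<and> ireg s ''hi'' = hi"

lemma halts_merge_loop:
  assumes st: "merge_state n a y f w lo mid hi s"
    and le: "lo \<le> mid" "mid \<le> hi"
    and mono: "mono_on {lo..<mid} (a \<circ> f)" "mono_on {mid..<hi} (a \<circ> f)"
    and init: "ireg s ''i'' = lo" "ireg s ''j'' = mid" "ireg s ''k'' = lo" "iarr s ''tmp'' = g0"
  shows "halts (While (ILess ''k'' ''hi'') merge_body) s (20 * (hi - lo) + 1)
     (\<lambda>s'. merge_state n a y f w lo mid hi s' \<and> merge_inv a f g0 (iarr s' ''tmp'') lo mid hi mid hi hi)"
proof (rule halts_While[where T = "\<lambda>_. 16" and V = "\<lambda>s. 20 * (hi - ireg s ''k'')" and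
    I = "\<lambda>s. merge_state n a y f w lo mid hi s \<and>
      merge_inv a f g0 (iarr s ''tmp'') lo mid hi (ireg s ''i'') (ireg s ''j'') (ireg s ''k'')"])
  show "merge_state n a y f w lo mid hi s \<and>
      merge_inv a f g0 (iarr s ''tmp'') lo mid hi (ireg s ''i'') (ireg s ''j'') (ireg s ''k'')"
    using st init le by (simp add: merge_inv_init)
  fix s
  let ?I = "\<lambda>s. merge_state n a y f w lo mid hi s \<and>
      merge_inv a f g0 (iarr s ''tmp'') lo mid hi (ireg s ''i'') (ireg s ''j'') (ireg s ''k'')"
  assume I: "?I s"
  define g i j k where ds: "g = iarr s ''tmp''" "i = ireg s ''i''" "j = ireg s ''j''" "k = ireg s ''k''"
  note inv = conjunct2[OF I, folded ds]
  have b: "lo \<le> i" "i \<le> mid" "mid \<le> j" "j \<le> hi" "k + mid = i + j"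
    using inv by (auto simp: merge_inv_def)
  {
    assume "eval_test (ILess ''k'' ''hi'') s"
    then have k: "k < hi" using I by (simp add: ds merge_state_def)
    \<comment> \<open>\<open>L\<close> condenses the nested tests: it holds exactly when the left
      head is written.\<close>
    define L where "L \<longleftrightarrow> i < mid \<and> (j < hi \<longrightarrow> a (f i) \<le> a (f j))"
    define s' where "s' = sem merge_body s"
    have s': "merge_state n a y f w lo mid hi s'"
      using I by (simp add: s'_def merge_body_def take_left_def take_right_def merge_state_def env_def)
    have k': "ireg s' ''k'' = Suc k"
      using I by (simp add: s'_def merge_body_def take_left_def take_right_def merge_state_def env_def ds)
    have res: "iarr s' ''tmp'' = (if L then g(k := f i) else g(k := f j))"
      "ireg s' ''i'' = (if L then Suc i else i)" "ireg s' ''j'' = (if L then j else Suc j)"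
      using I by (auto simp: s'_def merge_body_def take_left_def take_right_def merge_state_def env_def ds L_def)
    have "?I s'"
    proof (cases L)
      case True
      then show ?thesis
        using s' k' res merge_inv_left[OF inv mono] by (simp add: L_def)
    next
      case False
      \<comment> \<open>If i = mid, then k + mid = i + j gives j = k < hi; otherwise the failed
        comparison itself includes j < hi.\<close>
      then have "j < hi" "i < mid \<Longrightarrow> a (f j) \<le> a (f i)" using b k by (auto simp: L_def)
      then show ?thesis
        using False s' k' res merge_inv_right[OF inv mono] by simp
    qed
    then have "?I s' \<and> 20 * (hi - ireg s' ''k'') + 16 + 1 \<le> 20 * (hi - ireg s ''k'')"
      using k k' by (simp add: ds)
    then show "halts merge_body s 16 (\<lambda>s'. ?I s' \<and> 20 * (hi - ireg s' ''k'') + 16 + 1 \<le> 20 * (hi - ireg s ''k''))"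
      unfolding s'_def
      by (rule halts_loop_free[rotated 2]) (simp_all add: merge_body_def take_left_def take_right_def)
  }
  assume "\<not> eval_test (ILess ''k'' ''hi'') s"
  then have "hi \<le> k" using I by (simp add: ds merge_state_def)
  then have "i = mid" "j = hi" "k = hi" using b by auto
  then show "merge_state n a y f w lo mid hi s \<and> merge_inv a f g0 (iarr s ''tmp'') lo mid hi mid hi hi"
    using I by (simp add: ds)
qed (use init in simp)

text \<open>\<open>min\<close> truncates the last block, and blocks starting beyond \<open>n\<close>
  are empty intervals; thus any length \<open>n\<close> is covered, not only multiples of
  \<open>w\<close>.\<close>

definition blocks_sorted :: "(nat \<Rightarrow> real) \<Rightarrow> (nat \<Rightarrow> nat) \<Rightarrow> nat \<Rightarrow> nat \<Rightarrow> bool" where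
  "blocks_sorted a f w n \<longleftrightarrow> (\<forall>q. mono_on {q * w..<min (Suc q * w) n} (a \<circ> f))"

text \<open>Divisibility is claimed only while \<open>lo < n\<close>: a truncated last block leaves
  \<open>lo = n\<close>, which may fail to be a multiple of \<open>2 * w\<close>.\<close>

definition pass_inv :: "(nat \<Rightarrow> real) \<Rightarrow> (nat \<Rightarrow> nat) \<Rightarrow> (nat \<Rightarrow> nat) \<Rightarrow> nat \<Rightarrow> nat \<Rightarrow> nat \<Rightarrow> bool" where
  "pass_inv a f g w n lo \<longleftrightarrow> lo \<le> n \<and> (lo < n \<longrightarrow> 2 * w dvd lo) \<and>
     g ` {..<lo} = f ` {..<lo} \<and> blocks_sorted a g (2 * w) lo"

lemma mono_on_cong:
  assumes "\<And>q. q \<in> S \<Longrightarrow> h q = h' q"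
  shows "mono_on S h \<longleftrightarrow> mono_on S h'"
  using assms by (auto simp: monotone_on_def)

text \<open>At lo = (2 * q) * w the two runs are the old blocks with numbers 2 * q and 2 * q + 1.
  When the first one is cut off at \<open>n\<close>, the second is empty.\<close>

lemma blocks_sorted_halves:
  assumes bs: "blocks_sorted a f w n" and lo: "2 * w dvd lo"
    and mid: "mid = min (lo + w) n" and hi: "hi = min (mid + w) n"
  shows "mono_on {lo..<mid} (a \<circ> f)" "mono_on {mid..<hi} (a \<circ> f)"
proof -
  obtain q where q: "lo = (2 * q) * w" using lo by (auto simp: dvd_def mult_ac)
  show "mono_on {lo..<mid} (a \<circ> f)"
    using bs[unfolded blocks_sorted_def, rule_format, of "2 * q"] by (simp add: q mid add.commute)
  show "mono_on {mid..<hi} (a \<circ> f)"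
  proof (cases "lo + w \<le> n")
    case True
    then show ?thesis
      using bs[unfolded blocks_sorted_def, rule_format, of "Suc (2 * q)"]
      by (simp add: q mid hi algebra_simps)
  next
    case False
    then show ?thesis by (auto simp: mid hi intro: mono_onI)
  qed
qed

text \<open>New blocks before the one starting at \<open>lo\<close> are untouched, that one is the
  merged run, and later ones are still empty when cut off at \<open>hi\<close>.\<close>

lemma pass_inv_step:
  assumes inv: "pass_inv a f g w n lo" and lo: "lo < n"
    and mid: "mid = min (lo + w) n" and hi: "hi = min (mid + w) n"
    and merged: "merge_inv a f g g' lo mid hi mid hi hi"
  shows "pass_inv a f g' w n hi"
proof -
  have le: "lo \<le> mid" "mid \<le> hi" "hi \<le> n" using lo by (auto simp: mid hi)
  have old: "g' q = g q" if "q < lo" for q using merged that by (simp add: merge_inv_def)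
  have mono: "mono_on {lo..<hi} (a \<circ> g')" and img: "g' ` {lo..<hi} = f ` {lo..<hi}"
    using merged le by (auto simp: merge_inv_def ivl_disj_un)
  have dvd: "2 * w dvd lo" using inv lo by (simp add: pass_inv_def)
  then obtain q0 where q0: "lo = q0 * (2 * w)" by (auto simp: dvd_def mult_ac)
  \<comment> \<open>A merge advances by less than a full double block only if it reaches
    \<open>n\<close>, so divisibility survives in every case that goes on.\<close>
  have full: "hi = lo + 2 * w" if "hi < n" using that by (auto simp: mid hi)
  have ub: "hi \<le> lo + 2 * w" by (auto simp: mid hi)
  have img': "g' ` {..<hi} = f ` {..<hi}"
  proof -
    have "{..<hi} = {..<lo} \<union> {lo..<hi}" using le by auto
    moreover have "g' ` {..<lo} = g ` {..<lo}" by (rule image_cong) (auto simp: old)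
    moreover have "g ` {..<lo} = f ` {..<lo}" using inv by (simp add: pass_inv_def)
    ultimately show ?thesis using img by (simp add: image_Un)
  qed
  have "mono_on {q * (2 * w)..<min (Suc q * (2 * w)) hi} (a \<circ> g')" for q
  proof -
    consider "q < q0" | "q = q0" | "q > q0" by linarith
    then show ?thesis
    proof cases
      case 1
      then have "Suc q * (2 * w) \<le> lo" unfolding q0 by (intro mult_le_mono1) simp
      then have "min (Suc q * (2 * w)) hi = min (Suc q * (2 * w)) lo" using le by simp
      moreover have "mono_on {q * (2 * w)..<min (Suc q * (2 * w)) lo} (a \<circ> g)"
        using inv unfolding pass_inv_def blocks_sorted_def by blast
      moreover have "mono_on {q * (2 * w)..<min (Suc q * (2 * w)) lo} (a \<circ> g')
          \<longleftrightarrow> mono_on {q * (2 * w)..<min (Suc q * (2 * w)) lo} (a \<circ> g)"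
        by (rule mono_on_cong) (simp add: old)
      ultimately show ?thesis by simp
    next
      case 2
      then have "Suc q * (2 * w) \<ge> hi" using ub q0 by simp
      then show ?thesis using mono 2 q0 by (simp add: min_def)
    next
      case 3
      then have "Suc q0 * (2 * w) \<le> q * (2 * w)" by (intro mult_le_mono1) simp
      then have "hi \<le> q * (2 * w)" using ub q0 by simp
      then show ?thesis by (auto intro: mono_onI)
    qed
  qed
  then show ?thesis
    unfolding pass_inv_def blocks_sorted_def using le img' full dvd by auto
qed

definition merge_setup :: com where
  "merge_setup =
     instrs [IAdd ''mid'' ''lo'' ''w''] ;;
     If (ILess ''n'' ''mid'') (instrs [IMove ''mid'' ''n'']) Skip ;;
     instrs [IAdd ''hi'' ''mid'' ''w''] ;;
     If (ILess ''n'' ''hi'') (instrs [IMove ''hi'' ''n'']) Skip ;;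
     instrs [IMove ''i'' ''lo'', IMove ''j'' ''mid'', IMove ''k'' ''lo'']"

definition merge_block :: com where
  "merge_block = merge_setup ;; While (ILess ''k'' ''hi'') merge_body ;; instrs [IMove ''lo'' ''hi'']"

definition sort_state :: "nat \<Rightarrow> (nat \<Rightarrow> real) \<Rightarrow> (nat \<Rightarrow> real) \<Rightarrow> (nat \<Rightarrow> nat) \<Rightarrow> nat \<Rightarrow> ram_state \<Rightarrow> bool" where
  "sort_state n a y f w s \<longleftrightarrow> env n a y s \<and> iarr s ''idx'' = f \<and> ireg s ''w'' = w"

text \<open>Beyond 20 units per merged element, the 17 are 14 for the setup, 1 for the failing loop
  test and 2 for moving \<open>lo\<close>.\<close>

lemma halts_merge_block:
  assumes st: "sort_state n a y f w s" and bs: "blocks_sorted a f w n"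
    and inv: "pass_inv a f (iarr s ''tmp'') w n (ireg s ''lo'')" and lo: "ireg s ''lo'' < n"
    and hi: "hi = min (min (ireg s ''lo'' + w) n + w) n"
  shows "halts merge_block s (20 * (hi - ireg s ''lo'') + 17) (\<lambda>s'. sort_state n a y f w s' \<and>
     pass_inv a f (iarr s' ''tmp'') w n (ireg s' ''lo'') \<and> ireg s' ''lo'' = hi)"
proof -
  define g l mid where ds: "g = iarr s ''tmp''" "l = ireg s ''lo''" "mid = min (l + w) n"
  have hi': "hi = min (mid + w) n" by (simp add: ds hi)
  have le: "l \<le> mid" "mid \<le> hi" using lo by (auto simp: ds hi)
  have dvd: "2 * w dvd l" using inv lo by (simp add: pass_inv_def ds)
  note mono = blocks_sorted_halves[OF bs dvd ds(3) hi']
  define s1 where "s1 = sem merge_setup s"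
  have s1: "merge_state n a y f w l mid hi s1" "ireg s1 ''i'' = l" "ireg s1 ''j'' = mid"
      "ireg s1 ''k'' = l" "iarr s1 ''tmp'' = g"
    using st by (auto simp: s1_def merge_setup_def merge_state_def sort_state_def env_def ds hi min_def)
  show ?thesis
    unfolding merge_block_def
  proof (rule halts_Seq[where R = "\<lambda>s'. s' = s1" and ?T1.0 = 14])
    show "halts merge_setup s 14 (\<lambda>s'. s' = s1)"
      by (rule halts_loop_free) (simp_all add: s1_def, simp_all add: merge_setup_def)
    fix s' assume s': "s' = s1"
    show "halts (While (ILess ''k'' ''hi'') merge_body ;; instrs [IMove ''lo'' ''hi'']) s'
       (20 * (hi - ireg s ''lo'') + 3) (\<lambda>s'. sort_state n a y f w s' \<and>
     pass_inv a f (iarr s' ''tmp'') w n (ireg s' ''lo'') \<and> ireg s' ''lo'' = hi)"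
      unfolding s'
    proof (rule halts_Seq[OF halts_merge_loop[OF s1(1) le mono s1(2-5)], where ?T2.0 = 2])
      fix s2 assume s2: "merge_state n a y f w l mid hi s2 \<and>
          merge_inv a f g (iarr s2 ''tmp'') l mid hi mid hi hi"
      then have "pass_inv a f (iarr s2 ''tmp'') w n hi"
        using pass_inv_step[OF inv[folded ds] lo[folded ds] ds(3) hi'] by blast
      then show "halts (instrs [IMove ''lo'' ''hi'']) s2 2 (\<lambda>s'. sort_state n a y f w s' \<and>
          pass_inv a f (iarr s' ''tmp'') w n (ireg s' ''lo'') \<and> ireg s' ''lo'' = hi)"
        using s2 by (intro halts_loop_free) (auto simp: merge_state_def sort_state_def env_def)
    qed (simp add: ds)
  qed simp
qed

definition copy_body :: com where
  "copy_body = instrs [ILoad ''u'' ''tmp'' ''i'', IStore ''idx'' ''i'' ''u'', IAdd ''i'' ''i'' ''one'']"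

definition merge_pass :: com where
  "merge_pass = instrs [IConst ''lo'' 0] ;; While (ILess ''lo'' ''n'') merge_block ;;
     instrs [IConst ''i'' 0] ;; While (ILess ''i'' ''n'') copy_body ;;
     instrs [IAdd ''w'' ''w'' ''w'']"

definition merge_sort :: com where
  "merge_sort = instrs [IConst ''w'' 1] ;; While (ILess ''w'' ''n'') merge_pass"

lemma halts_merge_blocks:
  assumes st: "sort_state n a y f w s" and bs: "blocks_sorted a f w n" and w: "w \<ge> 1"
    and lo: "ireg s ''lo'' = 0"
  shows "halts (While (ILess ''lo'' ''n'') merge_block) s (40 * n + 1)
    (\<lambda>s'. sort_state n a y f w s' \<and> iarr s' ''tmp'' ` {..<n} = f ` {..<n} \<and>
       blocks_sorted a (iarr s' ''tmp'') (2 * w) n)"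
\<comment> \<open>Of the 40 units per element, 20 pay for merging. The other 20 cover the fixed cost
  of a block and its loop test, 17 + 1, since \<open>w \<ge> 1\<close> makes each block advance by
  at least one element. So a pass stays linear even when its blocks are short.\<close>
proof (rule halts_While[where V = "\<lambda>s. 40 * (n - ireg s ''lo'')" and
    T = "\<lambda>s. 20 * (min (min (ireg s ''lo'' + w) n + w) n - ireg s ''lo'') + 17" and
    I = "\<lambda>s. sort_state n a y f w s \<and> pass_inv a f (iarr s ''tmp'') w n (ireg s ''lo'')"])
  show "sort_state n a y f w s \<and> pass_inv a f (iarr s ''tmp'') w n (ireg s ''lo'')"
    using st lo by (auto simp: pass_inv_def blocks_sorted_def intro: mono_onI)
  fix s assume I: "sort_state n a y f w s \<and> pass_inv a f (iarr s ''tmp'') w n (ireg s ''lo'')"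
  {
    assume "eval_test (ILess ''lo'' ''n'') s"
    then have lo: "ireg s ''lo'' < n" using I by (simp add: sort_state_def env_def)
    define hi where "hi = min (min (ireg s ''lo'' + w) n + w) n"
    have "ireg s ''lo'' < hi" "hi \<le> n" using lo w by (auto simp: hi_def)
    then show "halts merge_block s (20 * (min (min (ireg s ''lo'' + w) n + w) n - ireg s ''lo'') + 17)
       (\<lambda>s'. (sort_state n a y f w s' \<and> pass_inv a f (iarr s' ''tmp'') w n (ireg s' ''lo'')) \<and>
          40 * (n - ireg s' ''lo'') + (20 * (min (min (ireg s ''lo'' + w) n + w) n - ireg s ''lo'') + 17) + 1
          \<le> 40 * (n - ireg s ''lo''))"
      using I unfolding hi_def[symmetric]
      by (intro halts_mono[OF halts_merge_block[OF _ bs _ lo hi_def]]) auto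
  }
  assume "\<not> eval_test (ILess ''lo'' ''n'') s"
  then have "ireg s ''lo'' = n" using I by (simp add: sort_state_def env_def pass_inv_def)
  then show "sort_state n a y f w s \<and> iarr s ''tmp'' ` {..<n} = f ` {..<n} \<and>
       blocks_sorted a (iarr s ''tmp'') (2 * w) n"
    using I by (simp add: pass_inv_def)
qed (use lo in simp)

lemma halts_copy:
  assumes st: "env n a y s" "ireg s ''w'' = w" "iarr s ''tmp'' = g" "ireg s ''i'' = 0"
  shows "halts (While (ILess ''i'' ''n'') copy_body) s (5 * n + 1)
    (\<lambda>s'. env n a y s' \<and> ireg s' ''w'' = w \<and> (\<forall>q<n. iarr s' ''idx'' q = g q))"
proof (rule halts_While[where V = "\<lambda>s. 5 * (n - ireg s ''i'')" and T = "\<lambda>_. 4" and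
    I = "\<lambda>s. env n a y s \<and> ireg s ''w'' = w \<and> iarr s ''tmp'' = g \<and>
       (\<forall>q<ireg s ''i''. iarr s ''idx'' q = g q)"])
  fix s assume "env n a y s \<and> ireg s ''w'' = w \<and> iarr s ''tmp'' = g \<and>
       (\<forall>q<ireg s ''i''. iarr s ''idx'' q = g q)" and "eval_test (ILess ''i'' ''n'') s"
  then show "halts copy_body s 4 (\<lambda>s'. (env n a y s' \<and> ireg s' ''w'' = w \<and> iarr s' ''tmp'' = g \<and>
       (\<forall>q<ireg s' ''i''. iarr s' ''idx'' q = g q)) \<and> 5 * (n - ireg s' ''i'') + 4 + 1 \<le> 5 * (n - ireg s ''i''))"
    unfolding copy_body_def
    by (intro halts_loop_free) (auto simp: env_def less_Suc_eq)
qed (use st in \<open>auto simp: env_def\<close>)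

lemma halts_merge_pass:
  assumes st: "sort_state n a y f w s" and bs: "blocks_sorted a f w n" and w: "w \<ge> 1"
  shows "halts merge_pass s (45 * n + 8)
    (\<lambda>s'. env n a y s' \<and> ireg s' ''w'' = 2 * w \<and> iarr s' ''idx'' ` {..<n} = f ` {..<n} \<and>
       blocks_sorted a (iarr s' ''idx'') (2 * w) n)" (is "halts _ _ _ ?Q")
  unfolding merge_pass_def
proof (rule halts_Seq[where R = "\<lambda>s. sort_state n a y f w s \<and> ireg s ''lo'' = 0" and ?T1.0 = 2])
  show "halts (instrs [IConst ''lo'' 0]) s 2 (\<lambda>s. sort_state n a y f w s \<and> ireg s ''lo'' = 0)"
    using st by (intro halts_loop_free) (auto simp: sort_state_def env_def)
  fix s1 assume s1: "sort_state n a y f w s1 \<and> ireg s1 ''lo'' = 0"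
  show "halts (While (ILess ''lo'' ''n'') merge_block ;;
     instrs [IConst ''i'' 0] ;; While (ILess ''i'' ''n'') copy_body ;;
     instrs [IAdd ''w'' ''w'' ''w'']) s1 (45 * n + 6) ?Q"
  proof (rule halts_Seq[OF halts_merge_blocks[OF conjunct1[OF s1] bs w conjunct2[OF s1]], where ?T2.0 = "5 * n + 5"])
    fix s2 assume s2: "sort_state n a y f w s2 \<and> iarr s2 ''tmp'' ` {..<n} = f ` {..<n} \<and>
       blocks_sorted a (iarr s2 ''tmp'') (2 * w) n"
    define g where "g = iarr s2 ''tmp''"
    show "halts (instrs [IConst ''i'' 0] ;; While (ILess ''i'' ''n'') copy_body ;;
       instrs [IAdd ''w'' ''w'' ''w'']) s2 (5 * n + 5) ?Q"
    proof (rule halts_Seq[where ?T1.0 = 2 and ?T2.0 = "5 * n + 3" and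
          R = "\<lambda>s. env n a y s \<and> ireg s ''w'' = w \<and> iarr s ''tmp'' = g \<and> ireg s ''i'' = 0"])
      show "halts (instrs [IConst ''i'' 0]) s2 2
         (\<lambda>s. env n a y s \<and> ireg s ''w'' = w \<and> iarr s ''tmp'' = g \<and> ireg s ''i'' = 0)"
        using s2 by (intro halts_loop_free) (auto simp: sort_state_def env_def g_def)
      fix s3 assume s3: "env n a y s3 \<and> ireg s3 ''w'' = w \<and> iarr s3 ''tmp'' = g \<and> ireg s3 ''i'' = 0"
      show "halts (While (ILess ''i'' ''n'') copy_body ;; instrs [IAdd ''w'' ''w'' ''w'']) s3 (5 * n + 3) ?Q"
      proof (rule halts_Seq[OF halts_copy, where ?T2.0 = 2])
        fix s4 assume s4: "env n a y s4 \<and> ireg s4 ''w'' = w \<and> (\<forall>q<n. iarr s4 ''idx'' q = g q)"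
        have "iarr s4 ''idx'' ` {..<n} = g ` {..<n}" using s4 by (intro image_cong) auto
        moreover have "blocks_sorted a (iarr s4 ''idx'') (2 * w) n \<longleftrightarrow> blocks_sorted a g (2 * w) n"
          unfolding blocks_sorted_def using s4 by (intro all_cong1 mono_on_cong) simp
        ultimately show "halts (instrs [IAdd ''w'' ''w'' ''w'']) s4 2 ?Q"
          using s2 s4 by (intro halts_loop_free) (auto simp: env_def g_def)
      qed (use s3 in auto)
    qed simp
  qed simp
qed simp

text \<open>After k passes the width is 2^k, so at most \<open>L\<close> passes happen before it
  reaches \<open>n\<close>. Keeping \<open>L\<close> free leaves the rounding of the logarithm to
  \<open>gamma_time_bound\<close>.\<close>

lemma halts_merge_sort:
  assumes st: "env n a y s" and perm: "iarr s ''idx'' ` {..<n} = {..<n}" and n: "n \<le> 2 ^ L"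
  shows "halts merge_sort s ((45 * n + 9) * L + 3)
    (\<lambda>s'. env n a y s' \<and> iarr s' ''idx'' ` {..<n} = {..<n} \<and> mono_on {..<n} (a \<circ> iarr s' ''idx''))"
    (is "halts _ _ _ ?Q")
  unfolding merge_sort_def
proof (rule halts_Seq[where ?T1.0 = 2 and ?T2.0 = "(45 * n + 9) * L + 1" and
      R = "\<lambda>s. env n a y s \<and> iarr s ''idx'' ` {..<n} = {..<n} \<and> ireg s ''w'' = 1"])
  show "halts (instrs [IConst ''w'' 1]) s 2
     (\<lambda>s. env n a y s \<and> iarr s ''idx'' ` {..<n} = {..<n} \<and> ireg s ''w'' = 1)"
    using st perm by (intro halts_loop_free) (auto simp: env_def)
  \<comment> \<open>No register counts the passes. The potential must be a function of the state, so
    their number is read off from the width.\<close>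
  define lg where "lg w = nat \<lfloor>log 2 (real w)\<rfloor>" for w
  have lg: "lg (2 ^ k) = k" for k by (simp add: lg_def)
  let ?I = "\<lambda>s. env n a y s \<and> iarr s ''idx'' ` {..<n} = {..<n} \<and>
      blocks_sorted a (iarr s ''idx'') (ireg s ''w'') n \<and> (\<exists>k\<le>L. ireg s ''w'' = 2 ^ k)"
  fix s1 assume s1: "env n a y s1 \<and> iarr s1 ''idx'' ` {..<n} = {..<n} \<and> ireg s1 ''w'' = 1"
  show "halts (While (ILess ''w'' ''n'') merge_pass) s1 ((45 * n + 9) * L + 1) ?Q"
  proof (rule halts_While[where I = ?I and V = "\<lambda>s. (45 * n + 9) * (L - lg (ireg s ''w''))" and
        T = "\<lambda>_. 45 * n + 8"])
    show "?I s1"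
      using s1 by (auto simp: blocks_sorted_def le_less_Suc_eq intro!: mono_onI exI[of _ 0])
    show "(45 * n + 9) * (L - lg (ireg s1 ''w'')) + 1 \<le> (45 * n + 9) * L + 1" by simp
    fix s assume I: "?I s"
    then obtain k where k: "k \<le> L" "ireg s ''w'' = 2 ^ k" by blast
    {
      assume "eval_test (ILess ''w'' ''n'') s"
      then have "2 ^ k < n" using I k by (simp add: env_def)
      then have "(2::nat) ^ k < 2 ^ L" using n by linarith
      then have kL: "k < L" by simp
      have st: "sort_state n a y (iarr s ''idx'') (2 ^ k) s" using I k by (simp add: sort_state_def)
      show "halts merge_pass s (45 * n + 8)
          (\<lambda>s'. ?I s' \<and> (45 * n + 9) * (L - lg (ireg s' ''w'')) + (45 * n + 8) + 1
             \<le> (45 * n + 9) * (L - lg (ireg s ''w'')))"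
      proof (rule halts_mono[OF halts_merge_pass[OF st]])
        show "blocks_sorted a (iarr s ''idx'') (2 ^ k) n" using I k by simp
        fix s' assume s': "env n a y s' \<and> ireg s' ''w'' = 2 * 2 ^ k \<and>
            iarr s' ''idx'' ` {..<n} = iarr s ''idx'' ` {..<n} \<and>
            blocks_sorted a (iarr s' ''idx'') (2 * 2 ^ k) n"
        have w': "ireg s' ''w'' = 2 ^ Suc k" using s' by simp
        have "L - k = Suc (L - Suc k)" using kL by simp
        then have "(45 * n + 9) * (L - lg (ireg s' ''w'')) + (45 * n + 8) + 1
             \<le> (45 * n + 9) * (L - lg (ireg s ''w''))"
          unfolding w' k(2) lg by simp
        moreover have "?I s'"
          using s' I kL w' by (auto intro!: exI[of _ "Suc k"])
        ultimately show "?I s' \<and> (45 * n + 9) * (L - lg (ireg s' ''w'')) + (45 * n + 8) + 1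
             \<le> (45 * n + 9) * (L - lg (ireg s ''w''))" by blast
      qed auto
    }
    assume "\<not> eval_test (ILess ''w'' ''n'') s"
    then have "n \<le> ireg s ''w''" using I by (simp add: env_def)
    \<comment> \<open>Once the width is at least \<open>n\<close>, block number 0 is the whole
      array.\<close>
    moreover have "mono_on {0 * ireg s ''w''..<min (Suc 0 * ireg s ''w'') n} (a \<circ> iarr s ''idx'')"
      using I unfolding blocks_sorted_def by blast
    ultimately show "?Q s" using I by (simp add: min_absorb2 lessThan_atLeast0)
  qed
qed simp

section \<open>Two-pointer sweep\<close>

definition sweep_advance :: com where
  "sweep_advance = instrs [RLoad ''t'' ''y'' ''v'', RAdd ''C'' ''C'' ''one'', RAdd ''S'' ''S'' ''z'',
     RAdd ''Cy'' ''Cy'' ''t'', RMul ''t'' ''t'' ''z'', RAdd ''Sy'' ''Sy'' ''t'', IAdd ''r'' ''r'' ''one'']"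

text \<open>Evaluates the closed form of \<open>sweep_val_prefix\<close> at the threshold in
  \<open>q\<close>, with the prefix count and sums in \<open>C\<close>, \<open>S\<close>,
  \<open>Cy\<close>, \<open>Sy\<close>. Adding with sign \<open>sg\<close> to the stored value lets
  the same code handle both thresholds.\<close>

definition sweep_emit :: com where
  "sweep_emit = instrs [RLoad ''t'' ''y'' ''u'', RMul ''x'' ''C'' ''q'', RSub ''x'' ''x'' ''S'',
     RMul ''x'' ''t'' ''x'', RMul ''t'' ''Cy'' ''q'', RSub ''t'' ''t'' ''Sy'', RSub ''x'' ''x'' ''t'',
     RDiv ''x'' ''x'' ''two'', RMul ''x'' ''x'' ''sg'', RLoad ''t'' ''gamma'' ''u'',
     RAdd ''t'' ''t'' ''x'', RStore ''gamma'' ''u'' ''t'', IAdd ''k'' ''k'' ''one'']"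

text \<open>The usual nested loops of a two-pointer scan are flattened: an iteration either extends
  the prefix or emits one value. A single potential in both pointers then shows linear time.\<close>

definition sweep_body :: com where
  "sweep_body =
     instrs [ILoad ''u'' ''idx'' ''k'', RLoad ''q'' ''a'' ''u'', RAdd ''q'' ''q'' ''c''] ;;
     If (ILess ''r'' ''n'')
       (instrs [ILoad ''v'' ''idx'' ''r'', RLoad ''z'' ''a'' ''v''] ;;
        If (RLess ''z'' ''q'') sweep_advance sweep_emit)
       sweep_emit"

definition sweep :: com where
  "sweep = instrs [IConst ''k'' 0, IConst ''r'' 0, RConst ''C'' 0, RConst ''S'' 0,
       RConst ''Cy'' 0, RConst ''Sy'' 0] ;;
     While (ILess ''k'' ''n'') sweep_body"

definition sweep_val :: "nat \<Rightarrow> (nat \<Rightarrow> real) \<Rightarrow> (nat \<Rightarrow> real) \<Rightarrow> real \<Rightarrow> nat \<Rightarrow> real" where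
  "sweep_val n a y c u = (\<Sum>l<n. (y u - y l) * max (a u + c - a l) 0) / 2"

text \<open>A map of a finite set onto itself is injective; this is why the sorting invariants may
  speak about images only.\<close>

lemma sum_permuted:
  fixes h :: "nat \<Rightarrow> 'a :: comm_monoid_add"
  assumes "f ` {..<n} = {..<n}"
  shows "(\<Sum>l<n. h (f l)) = (\<Sum>l<n. h l)"
proof -
  have "inj_on f {..<n}" using assms by (intro eq_card_imp_inj_on) auto
  then have "bij_betw f {..<n} {..<n}" using assms by (simp add: bij_betw_def)
  then show ?thesis by (rule sum.reindex_bij_betw)
qed

text \<open>The elements below the threshold form a prefix of the sorted order, and on that prefix the
  sum is a combination of four prefix sums.\<close>

lemma sweep_val_prefix:
  assumes perm: "f ` {..<n} = {..<n}" and r: "r \<le> n"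
    and below: "\<And>l. l < r \<Longrightarrow> a (f l) < a u + c"
    and above: "\<And>l. r \<le> l \<Longrightarrow> l < n \<Longrightarrow> a u + c \<le> a (f l)"
  shows "sweep_val n a y c u =
    (y u * (real r * (a u + c) - (\<Sum>l<r. a (f l)))
      - ((\<Sum>l<r. y (f l)) * (a u + c) - (\<Sum>l<r. y (f l) * a (f l)))) / 2"
proof -
  let ?h = "\<lambda>l. (y u - y l) * max (a u + c - a l) 0"
  have "(\<Sum>l<n. ?h l) = (\<Sum>l<n. ?h (f l))" by (rule sum_permuted[OF perm, symmetric])
  also have "\<dots> = (\<Sum>l<r. ?h (f l))"
    using r above by (intro sum.mono_neutral_right) auto
  also have "\<dots> = (\<Sum>l<r. y u * (a u + c) - y u * a (f l) - (y (f l) * (a u + c) - y (f l) * a (f l)))"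
  proof (intro sum.cong refl)
    fix l assume "l \<in> {..<r}"
    then have "max (a u + c - a (f l)) 0 = a u + c - a (f l)" using below[of l] by simp
    then show "?h (f l) = y u * (a u + c) - y u * a (f l) - (y (f l) * (a u + c) - y (f l) * a (f l))"
      by (simp add: algebra_simps)
  qed
  also have "\<dots> = y u * (real r * (a u + c) - (\<Sum>l<r. a (f l)))
      - ((\<Sum>l<r. y (f l)) * (a u + c) - (\<Sum>l<r. y (f l) * a (f l)))"
    by (simp add: sum_subtractf sum_distrib_left sum_distrib_right right_diff_distrib)
  finally show ?thesis by (simp add: sweep_val_def)
qed

definition sweep_state :: "nat \<Rightarrow> (nat \<Rightarrow> real) \<Rightarrow> (nat \<Rightarrow> real) \<Rightarrow> (nat \<Rightarrow> nat) \<Rightarrow> real \<Rightarrow> real \<Rightarrow>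
    ram_state \<Rightarrow> bool" where
  "sweep_state n a y f c \<sigma> s \<longleftrightarrow>
     env n a y s \<and> iarr s ''idx'' = f \<and> rreg s ''c'' = c \<and> rreg s ''sg'' = \<sigma>"

definition sweep_prefix :: "(nat \<Rightarrow> real) \<Rightarrow> (nat \<Rightarrow> real) \<Rightarrow> (nat \<Rightarrow> nat) \<Rightarrow> ram_state \<Rightarrow> bool" where
  "sweep_prefix a y f s \<longleftrightarrow> rreg s ''C'' = real (ireg s ''r'') \<and>
     rreg s ''S'' = (\<Sum>l<ireg s ''r''. a (f l)) \<and>
     rreg s ''Cy'' = (\<Sum>l<ireg s ''r''. y (f l)) \<and>
     rreg s ''Sy'' = (\<Sum>l<ireg s ''r''. y (f l) * a (f l))"

text \<open>Every iteration moves exactly one of the two pointers, and 24 units for each of at most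
  2n moves give 48n. A prefix element lies below the current threshold and, by sortedness, below all
  later ones, so nothing ever has to be removed from the prefix sums.\<close>

lemma halts_sweep_loop:
  assumes perm: "f ` {..<n} = {..<n}" and mono: "mono_on {..<n} (a \<circ> f)"
    and st: "sweep_state n a y f c \<sigma> s" "sweep_prefix a y f s" "ireg s ''k'' = 0" "ireg s ''r'' = 0"
    and g0: "rarr s ''gamma'' = g0"
  shows "halts (While (ILess ''k'' ''n'') sweep_body) s (48 * n + 1) (\<lambda>s'. sweep_state n a y f c \<sigma> s' \<and>
     (\<forall>m<n. rarr s' ''gamma'' (f m) = g0 (f m) + \<sigma> * sweep_val n a y c (f m)))"
proof -
  have inj: "inj_on f {..<n}" using perm by (intro eq_card_imp_inj_on) auto
  let ?I = "\<lambda>s. sweep_state n a y f c \<sigma> s \<and> sweep_prefix a y f s \<and> ireg s ''k'' \<le> n \<and> ireg s ''r'' \<le> n \<and>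
     (\<forall>l<ireg s ''r''. \<forall>m. ireg s ''k'' \<le> m \<longrightarrow> m < n \<longrightarrow> a (f l) < a (f m) + c) \<and>
     (\<forall>m<n. rarr s ''gamma'' (f m) =
        g0 (f m) + (if m < ireg s ''k'' then \<sigma> * sweep_val n a y c (f m) else 0))"
  show ?thesis
  proof (rule halts_While[where T = "\<lambda>_. 23" and I = ?I and
        V = "\<lambda>s. 24 * ((n - ireg s ''k'') + (n - ireg s ''r''))"])
    show "?I s" using st g0 by simp
    show "24 * ((n - ireg s ''k'') + (n - ireg s ''r'')) + 1 \<le> 48 * n + 1" by simp
    fix s assume I: "?I s"
    {
      assume "eval_test (ILess ''k'' ''n'') s"
      define k r where ds: "k = ireg s ''k''" "r = ireg s ''r''"
      have st: "sweep_state n a y f c \<sigma> s" and pre: "sweep_prefix a y f s" and r: "r \<le> n"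
        and below: "\<And>l m. l < r \<Longrightarrow> k \<le> m \<Longrightarrow> m < n \<Longrightarrow> a (f l) < a (f m) + c"
        and gam: "\<And>m. m < n \<Longrightarrow> rarr s ''gamma'' (f m) =
            g0 (f m) + (if m < k then \<sigma> * sweep_val n a y c (f m) else 0)"
        using I by (auto simp: ds)
      have k: "k < n"
        using \<open>eval_test (ILess ''k'' ''n'') s\<close> st by (simp add: ds sweep_state_def env_def)
      define s' where "s' = sem sweep_body s"
      have step: "?I s' \<and> Suc ((n - ireg s' ''k'') + (n - ireg s' ''r'')) \<le> (n - k) + (n - r)"
      proof (cases "r < n \<and> a (f r) < a (f k) + c")
        case True
        have s': "sweep_state n a y f c \<sigma> s'" "ireg s' ''k'' = k" "ireg s' ''r'' = Suc r"
            "rarr s' ''gamma'' = rarr s ''gamma''"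
          using True st by (auto simp: s'_def sweep_body_def sweep_advance_def sweep_state_def env_def ds)
        have pre': "sweep_prefix a y f s'"
          using True st pre
          by (auto simp: s'_def sweep_body_def sweep_advance_def sweep_state_def env_def ds sweep_prefix_def)
        have "a (f l) < a (f m) + c" if "l < Suc r" "k \<le> m" "m < n" for l m
        proof (cases "l = r")
          case True
          have "a (f k) \<le> a (f m)" using mono_onD[OF mono, of k m] that by simp
          then show ?thesis using True \<open>r < n \<and> a (f r) < a (f k) + c\<close> by simp
        qed (use below that in auto)
        then show ?thesis
          using s' pre' gam k True by auto
      next
        case False
        define u where "u = f k"
        have above: "a u + c \<le> a (f l)" if "r \<le> l" "l < n" for l
        proof -
          have "a (f r) \<le> a (f l)" using mono_onD[OF mono, of r l] that by simp
          then show ?thesis using False that by (simp add: u_def)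
        qed
        have val: "sweep_val n a y c u =
          (y u * (real r * (a u + c) - (\<Sum>l<r. a (f l)))
            - ((\<Sum>l<r. y (f l)) * (a u + c) - (\<Sum>l<r. y (f l) * a (f l)))) / 2"
          using below[of _ k] k above by (intro sweep_val_prefix[OF perm r]) (auto simp: u_def)
        have s': "sweep_state n a y f c \<sigma> s'" "ireg s' ''k'' = Suc k" "ireg s' ''r'' = r"
          using False st by (auto simp: s'_def sweep_body_def sweep_emit_def sweep_state_def env_def ds)
        have pre': "sweep_prefix a y f s'"
          using False st pre
          by (auto simp: s'_def sweep_body_def sweep_emit_def sweep_state_def env_def ds sweep_prefix_def)
        have gam': "rarr s' ''gamma'' = (rarr s ''gamma'')(u := rarr s ''gamma'' u + \<sigma> * sweep_val n a y c u)"
          unfolding val using False st pre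
          by (auto simp: s'_def sweep_body_def sweep_emit_def sweep_state_def env_def ds sweep_prefix_def u_def)
        have "rarr s' ''gamma'' (f m) =
            g0 (f m) + (if m < Suc k then \<sigma> * sweep_val n a y c (f m) else 0)" if m: "m < n" for m
        proof (cases "m = k")
          case True
          then show ?thesis using gam[OF k] by (simp add: gam' u_def)
        next
          case False
          then have "f m \<noteq> u" using inj m k by (auto simp: u_def inj_on_def)
          then show ?thesis using gam[OF m] False by (simp add: gam')
        qed
        then show ?thesis
          using s' pre' k r below by auto
      qed
      have arith: "24 * m + 23 + 1 \<le> 24 * m'" if "Suc m \<le> m'" for m m' :: nat
        using that by simp
      have "24 * ((n - ireg s' ''k'') + (n - ireg s' ''r'')) + 23 + 1
          \<le> 24 * ((n - ireg s ''k'') + (n - ireg s ''r''))"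
        by (rule arith[OF conjunct2[OF step, unfolded ds]])
      with conjunct1[OF step] have "?I s' \<and> 24 * ((n - ireg s' ''k'') + (n - ireg s' ''r'')) + 23 + 1
          \<le> 24 * ((n - ireg s ''k'') + (n - ireg s ''r''))"
        by (rule conjI)
      then show "halts sweep_body s 23 (\<lambda>s'. ?I s' \<and>
          24 * ((n - ireg s' ''k'') + (n - ireg s' ''r'')) + 23 + 1
          \<le> 24 * ((n - ireg s ''k'') + (n - ireg s ''r'')))"
        unfolding s'_def
        by (rule halts_loop_free[rotated 2])
          (simp_all add: sweep_body_def sweep_advance_def sweep_emit_def)
    }
    assume "\<not> eval_test (ILess ''k'' ''n'') s"
    then have "n \<le> ireg s ''k''" using I by (simp add: sweep_state_def env_def)
    then show "sweep_state n a y f c \<sigma> s \<and>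
     (\<forall>m<n. rarr s ''gamma'' (f m) = g0 (f m) + \<sigma> * sweep_val n a y c (f m))"
      using I by auto
  qed
qed

lemma halts_sweep:
  assumes perm: "f ` {..<n} = {..<n}" and mono: "mono_on {..<n} (a \<circ> f)"
    and st: "sweep_state n a y f c \<sigma> s" and g0: "rarr s ''gamma'' = g0"
  shows "halts sweep s (48 * n + 8) (\<lambda>s'. sweep_state n a y f c \<sigma> s' \<and>
     (\<forall>u<n. rarr s' ''gamma'' u = g0 u + \<sigma> * sweep_val n a y c u))"
  unfolding sweep_def
proof (rule halts_Seq[where ?T1.0 = 7 and ?T2.0 = "48 * n + 1" and R = "\<lambda>s. sweep_state n a y f c \<sigma> s \<and>
     sweep_prefix a y f s \<and> ireg s ''k'' = 0 \<and> ireg s ''r'' = 0 \<and> rarr s ''gamma'' = g0"])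
  show "halts (instrs [IConst ''k'' 0, IConst ''r'' 0, RConst ''C'' 0, RConst ''S'' 0,
       RConst ''Cy'' 0, RConst ''Sy'' 0]) s 7 (\<lambda>s. sweep_state n a y f c \<sigma> s \<and>
     sweep_prefix a y f s \<and> ireg s ''k'' = 0 \<and> ireg s ''r'' = 0 \<and> rarr s ''gamma'' = g0)"
    using st g0 by (intro halts_loop_free) (auto simp: sweep_state_def env_def sweep_prefix_def)
  fix s1 assume s1: "sweep_state n a y f c \<sigma> s1 \<and>
     sweep_prefix a y f s1 \<and> ireg s1 ''k'' = 0 \<and> ireg s1 ''r'' = 0 \<and> rarr s1 ''gamma'' = g0"
  show "halts (While (ILess ''k'' ''n'') sweep_body) s1 (48 * n + 1) (\<lambda>s'. sweep_state n a y f c \<sigma> s' \<and>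
     (\<forall>u<n. rarr s' ''gamma'' u = g0 u + \<sigma> * sweep_val n a y c u))"
  proof (rule halts_mono[OF halts_sweep_loop[OF perm mono, of y c \<sigma> s1 g0]])
    fix s' assume s': "sweep_state n a y f c \<sigma> s' \<and>
     (\<forall>m<n. rarr s' ''gamma'' (f m) = g0 (f m) + \<sigma> * sweep_val n a y c (f m))"
    have "\<exists>m<n. u = f m" if "u < n" for u using perm that by (metis imageE lessThan_iff)
    with s' show "sweep_state n a y f c \<sigma> s' \<and>
     (\<forall>u<n. rarr s' ''gamma'' u = g0 u + \<sigma> * sweep_val n a y c u)" by blast
  qed (use s1 in auto)
qed simp

section \<open>Label counts and starting values\<close>

definition count_body :: com where
  "count_body = instrs [RLoad ''z'' ''y'' ''i'', RAdd ''Y'' ''Y'' ''z'', RAdd ''cnt'' ''cnt'' ''one'',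
     IAdd ''i'' ''i'' ''one'']"

text \<open>Sets the constant registers itself because it also opens the gradient program, which
  starts with arbitrary registers. \<open>cnt\<close> ends up as \<open>n\<close> in the form of a
  real number.\<close>

definition count_labels :: com where
  "count_labels = instrs [IConst ''i'' 0, IConst ''one'' 1, RConst ''one'' 1, RConst ''two'' 2,
      RConst ''Y'' 0, RConst ''cnt'' 0] ;; While (ILess ''i'' ''n'') count_body"

lemma halts_count_labels:
  assumes n: "ireg s ''n'' = n"
  shows "halts count_labels s (6 * n + 8) (\<lambda>s'. env n (rarr s ''a'') (rarr s ''y'') s' \<and>
     ireg s' ''p'' = ireg s ''p'' \<and> iarr s' = iarr s \<and> rarr s' = rarr s \<and>
     rreg s' ''Y'' = (\<Sum>i<n. rarr s ''y'' i) \<and> rreg s' ''cnt'' = real n)"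
proof -
  let ?I = "\<lambda>s'. env n (rarr s ''a'') (rarr s ''y'') s' \<and>
     ireg s' ''p'' = ireg s ''p'' \<and> iarr s' = iarr s \<and> rarr s' = rarr s \<and> ireg s' ''i'' \<le> n \<and>
     rreg s' ''Y'' = (\<Sum>i<ireg s' ''i''. rarr s ''y'' i) \<and> rreg s' ''cnt'' = real (ireg s' ''i'')"
  show ?thesis
    unfolding count_labels_def
  proof (rule halts_Seq[where ?T1.0 = 7 and ?T2.0 = "6 * n + 1" and R = ?I])
    show "halts (instrs [IConst ''i'' 0, IConst ''one'' 1, RConst ''one'' 1, RConst ''two'' 2,
      RConst ''Y'' 0, RConst ''cnt'' 0]) s 7 ?I"
      using n by (intro halts_loop_free) (auto simp: env_def)
    fix s1 assume s1: "?I s1"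
    show "halts (While (ILess ''i'' ''n'') count_body) s1 (6 * n + 1) (\<lambda>s'. env n (rarr s ''a'') (rarr s ''y'') s' \<and>
     ireg s' ''p'' = ireg s ''p'' \<and> iarr s' = iarr s \<and> rarr s' = rarr s \<and>
     rreg s' ''Y'' = (\<Sum>i<n. rarr s ''y'' i) \<and> rreg s' ''cnt'' = real n)"
    proof (rule halts_While[where I = ?I and V = "\<lambda>s. 6 * (n - ireg s ''i'')" and T = "\<lambda>_. 5", OF _ s1])
      fix s' assume "?I s'" "eval_test (ILess ''i'' ''n'') s'"
      then show "halts count_body s' 5 (\<lambda>s''. ?I s'' \<and> 6 * (n - ireg s'' ''i'') + 5 + 1 \<le> 6 * (n - ireg s' ''i''))"
        unfolding count_body_def by (intro halts_loop_free) (auto simp: env_def)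
    next
      fix s' assume "?I s'" "\<not> eval_test (ILess ''i'' ''n'') s'"
      moreover from this have "ireg s' ''i'' = n" by (simp add: env_def)
      ultimately show "env n (rarr s ''a'') (rarr s ''y'') s' \<and>
     ireg s' ''p'' = ireg s ''p'' \<and> iarr s' = iarr s \<and> rarr s' = rarr s \<and>
     rreg s' ''Y'' = (\<Sum>i<n. rarr s ''y'' i) \<and> rreg s' ''cnt'' = real n" by simp
    qed simp
  qed simp
qed

text \<open>The summand -1 in the decomposition of \<open>clip\<close> contributes (Y - n * y u) /
  2, with Y the sum of the labels; the sweeps add to this value.\<close>

definition init_gamma_body :: com where
  "init_gamma_body = instrs [RLoad ''z'' ''y'' ''i'', RMul ''z'' ''cnt'' ''z'',
     RSub ''z'' ''Y'' ''z'', RDiv ''z'' ''z'' ''two'', RStore ''gamma'' ''i'' ''z'',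
     IAdd ''i'' ''i'' ''one'']"

definition init_gamma :: com where
  "init_gamma = instrs [IConst ''i'' 0] ;; While (ILess ''i'' ''n'') init_gamma_body"

lemma halts_init_gamma:
  assumes st: "env n a y s" "iarr s ''idx'' = f" "rreg s ''Y'' = Y" "rreg s ''cnt'' = real n"
  shows "halts init_gamma s (8 * n + 3) (\<lambda>s'. env n a y s' \<and> iarr s' ''idx'' = f \<and>
     (\<forall>u<n. rarr s' ''gamma'' u = (Y - real n * y u) / 2))"
proof -
  let ?I = "\<lambda>s. env n a y s \<and> iarr s ''idx'' = f \<and> rreg s ''Y'' = Y \<and> rreg s ''cnt'' = real n \<and>
     (\<forall>u<ireg s ''i''. rarr s ''gamma'' u = (Y - real n * y u) / 2)"
  show ?thesis
    unfolding init_gamma_def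
  proof (rule halts_Seq[where ?T1.0 = 2 and ?T2.0 = "8 * n + 1" and R = ?I])
    show "halts (instrs [IConst ''i'' 0]) s 2 ?I"
      using st by (intro halts_loop_free) (auto simp: env_def)
    fix s1 assume s1: "?I s1"
    show "halts (While (ILess ''i'' ''n'') init_gamma_body) s1 (8 * n + 1) (\<lambda>s'. env n a y s' \<and>
       iarr s' ''idx'' = f \<and> (\<forall>u<n. rarr s' ''gamma'' u = (Y - real n * y u) / 2))"
    proof (rule halts_While[where I = ?I and V = "\<lambda>s. 8 * (n - ireg s ''i'')" and T = "\<lambda>_. 7", OF _ s1])
      fix s' assume "?I s'" "eval_test (ILess ''i'' ''n'') s'"
      then show "halts init_gamma_body s' 7 (\<lambda>s''. ?I s'' \<and> 8 * (n - ireg s'' ''i'') + 7 + 1 \<le> 8 * (n - ireg s' ''i''))"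
        unfolding init_gamma_body_def by (intro halts_loop_free) (auto simp: env_def less_Suc_eq)
    qed (auto simp: env_def)
  qed simp
qed

definition init_idx_body :: com where
  "init_idx_body = instrs [IStore ''idx'' ''i'' ''i'', IAdd ''i'' ''i'' ''one'']"

definition init_idx :: com where
  "init_idx = instrs [IConst ''one'' 1, RConst ''one'' 1, RConst ''two'' 2, IConst ''i'' 0] ;;
     While (ILess ''i'' ''n'') init_idx_body"

lemma halts_init_idx:
  assumes n: "ireg s ''n'' = n"
  shows "halts init_idx s (4 * n + 6) (\<lambda>s'. env n (rarr s ''a'') (rarr s ''y'') s' \<and>
     iarr s' ''idx'' ` {..<n} = {..<n})"
proof -
  let ?I = "\<lambda>s'. env n (rarr s ''a'') (rarr s ''y'') s' \<and> (\<forall>u<ireg s' ''i''. iarr s' ''idx'' u = u)"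
  show ?thesis
    unfolding init_idx_def
  proof (rule halts_Seq[where ?T1.0 = 5 and ?T2.0 = "4 * n + 1" and R = ?I])
    show "halts (instrs [IConst ''one'' 1, RConst ''one'' 1, RConst ''two'' 2, IConst ''i'' 0]) s 5 ?I"
      using n by (intro halts_loop_free) (auto simp: env_def)
    fix s1 assume s1: "?I s1"
    show "halts (While (ILess ''i'' ''n'') init_idx_body) s1 (4 * n + 1)
        (\<lambda>s'. env n (rarr s ''a'') (rarr s ''y'') s' \<and> iarr s' ''idx'' ` {..<n} = {..<n})"
    proof (rule halts_While[where I = ?I and V = "\<lambda>s. 4 * (n - ireg s ''i'')" and T = "\<lambda>_. 3", OF _ s1])
      fix s' assume "?I s'" "eval_test (ILess ''i'' ''n'') s'"
      then show "halts init_idx_body s' 3 (\<lambda>s''. ?I s'' \<and> 4 * (n - ireg s'' ''i'') + 3 + 1 \<le> 4 * (n - ireg s' ''i''))"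
        unfolding init_idx_body_def by (intro halts_loop_free) (auto simp: env_def less_Suc_eq)
    next
      fix s' assume s': "?I s'" "\<not> eval_test (ILess ''i'' ''n'') s'"
      then have "iarr s' ''idx'' ` {..<n} = id ` {..<n}" by (intro image_cong) (auto simp: env_def)
      then show "env n (rarr s ''a'') (rarr s ''y'') s' \<and> iarr s' ''idx'' ` {..<n} = {..<n}"
        using s' by simp
    qed simp
  qed simp
qed

definition gamma_prog :: com where
  "gamma_prog = init_idx ;; merge_sort ;; count_labels ;; init_gamma ;;
     instrs [RConst ''c'' 1, RConst ''sg'' 1] ;; sweep ;;
     instrs [RConst ''c'' (-1), RConst ''sg'' (-1)] ;; sweep"

text \<open>The three terms of \<open>clip_eq_diff_pos_parts\<close>, weighted and summed: the
  constant is the starting value, the other two are the sweeps with shift 1 and sign +1, and with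
  shift -1 and sign -1.\<close>

lemma half_sum_clip_eq:
  "(\<Sum>l<n. (y u - y l) * clip (a u - a l)) / 2
    = (\<Sum>l<n. y l) / 2 - real n * y u / 2 + sweep_val n a y 1 u - sweep_val n a y (-1) u"
proof -
  have "(\<Sum>l<n. (y u - y l) * clip (a u - a l)) =
    (\<Sum>l<n. y l - y u + (y u - y l) * max (a u + 1 - a l) 0 - (y u - y l) * max (a u + (-1) - a l) 0)"
    unfolding clip_eq_diff_pos_parts
    by (intro sum.cong refl) (simp add: algebra_simps)
  also have "\<dots> = (\<Sum>l<n. y l) - real n * y u + 2 * sweep_val n a y 1 u - 2 * sweep_val n a y (-1) u"
    by (simp only: sum.distrib sum_subtractf sweep_val_def) simp
  finally show ?thesis by simp
qed

text \<open>Speaks about arbitrary array contents; their meaning as labels and scores enters only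
  afterwards. The linear cost is 4n + 6n + 8n for indices, counting and starting values plus 48n for
  each sweep.\<close>

lemma halts_gamma_prog:
  assumes n: "ireg s ''n'' = n" "n \<le> 2 ^ L"
  defines "a \<equiv> rarr s ''a''" and "y \<equiv> rarr s ''y''"
  shows "halts gamma_prog s ((45 * n + 9) * L + 114 * n + 42)
    (\<lambda>s'. \<forall>u<n. rarr s' ''gamma'' u = (\<Sum>l<n. (y u - y l) * clip (a u - a l)) / 2)"
    (is "halts _ _ _ ?Q")
  unfolding gamma_prog_def
proof (rule halts_Seq[OF halts_init_idx[OF n(1), folded a_def y_def],
      where ?T2.0 = "(45 * n + 9) * L + 110 * n + 36"])
  fix s1 assume s1: "env n a y s1 \<and> iarr s1 ''idx'' ` {..<n} = {..<n}"
  show "halts (merge_sort ;; count_labels ;; init_gamma ;;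
     instrs [RConst ''c'' 1, RConst ''sg'' 1] ;; sweep ;;
     instrs [RConst ''c'' (-1), RConst ''sg'' (-1)] ;; sweep) s1 ((45 * n + 9) * L + 110 * n + 36) ?Q"
  proof (rule halts_Seq[OF halts_merge_sort[OF conjunct1[OF s1] conjunct2[OF s1] n(2)],
        where ?T2.0 = "110 * n + 33"])
    fix s2 assume s2: "env n a y s2 \<and> iarr s2 ''idx'' ` {..<n} = {..<n} \<and>
        mono_on {..<n} (a \<circ> iarr s2 ''idx'')"
    define f where "f = iarr s2 ''idx''"
    have perm: "f ` {..<n} = {..<n}" and mono: "mono_on {..<n} (a \<circ> f)"
      using s2 by (auto simp: f_def)
    have n2: "ireg s2 ''n'' = n" "rarr s2 ''a'' = a" "rarr s2 ''y'' = y" using s2 by (auto simp: env_def)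
    show "halts (count_labels ;; init_gamma ;;
       instrs [RConst ''c'' 1, RConst ''sg'' 1] ;; sweep ;;
       instrs [RConst ''c'' (-1), RConst ''sg'' (-1)] ;; sweep) s2 (110 * n + 33) ?Q"
    proof (rule halts_Seq[OF halts_count_labels[OF n2(1), unfolded n2], where ?T2.0 = "104 * n + 25"])
      fix s3 assume s3: "env n a y s3 \<and> ireg s3 ''p'' = ireg s2 ''p'' \<and> iarr s3 = iarr s2 \<and>
        rarr s3 = rarr s2 \<and> rreg s3 ''Y'' = (\<Sum>i<n. y i) \<and> rreg s3 ''cnt'' = real n"
      define Y where "Y = (\<Sum>i<n. y i)"
      have s3': "env n a y s3" "iarr s3 ''idx'' = f" "rreg s3 ''Y'' = Y" "rreg s3 ''cnt'' = real n"
        using s3 by (auto simp: f_def Y_def)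
      show "halts (init_gamma ;; instrs [RConst ''c'' 1, RConst ''sg'' 1] ;; sweep ;;
         instrs [RConst ''c'' (-1), RConst ''sg'' (-1)] ;; sweep) s3 (104 * n + 25) ?Q"
      proof (rule halts_Seq[OF halts_init_gamma[OF s3'], where ?T2.0 = "96 * n + 22"])
        fix s4 assume s4: "env n a y s4 \<and> iarr s4 ''idx'' = f \<and>
          (\<forall>u<n. rarr s4 ''gamma'' u = (Y - real n * y u) / 2)"
        define g where "g = rarr s4 ''gamma''"
        show "halts (instrs [RConst ''c'' 1, RConst ''sg'' 1] ;; sweep ;;
           instrs [RConst ''c'' (-1), RConst ''sg'' (-1)] ;; sweep) s4 (96 * n + 22) ?Q"
        proof (rule halts_Seq[where ?T1.0 = 3 and ?T2.0 = "96 * n + 19" and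
              R = "\<lambda>s. sweep_state n a y f 1 1 s \<and> rarr s ''gamma'' = g"])
          show "halts (instrs [RConst ''c'' 1, RConst ''sg'' 1]) s4 3
             (\<lambda>s. sweep_state n a y f 1 1 s \<and> rarr s ''gamma'' = g)"
            using s4 by (intro halts_loop_free) (auto simp: sweep_state_def env_def g_def)
          fix s5 assume s5: "sweep_state n a y f 1 1 s5 \<and> rarr s5 ''gamma'' = g"
          show "halts (sweep ;; instrs [RConst ''c'' (-1), RConst ''sg'' (-1)] ;; sweep) s5 (96 * n + 19) ?Q"
          proof (rule halts_Seq[OF halts_sweep[OF perm mono conjunct1[OF s5] conjunct2[OF s5]],
                where ?T2.0 = "48 * n + 11"])
            fix s6 assume s6: "sweep_state n a y f 1 1 s6 \<and>
              (\<forall>u<n. rarr s6 ''gamma'' u = g u + 1 * sweep_val n a y 1 u)"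
            define g' where "g' = rarr s6 ''gamma''"
            show "halts (instrs [RConst ''c'' (-1), RConst ''sg'' (-1)] ;; sweep) s6 (48 * n + 11) ?Q"
            proof (rule halts_Seq[where ?T1.0 = 3 and ?T2.0 = "48 * n + 8" and
                  R = "\<lambda>s. sweep_state n a y f (-1) (-1) s \<and> rarr s ''gamma'' = g'"])
              show "halts (instrs [RConst ''c'' (-1), RConst ''sg'' (-1)]) s6 3
                 (\<lambda>s. sweep_state n a y f (-1) (-1) s \<and> rarr s ''gamma'' = g')"
                using s6 by (intro halts_loop_free) (auto simp: sweep_state_def env_def g'_def)
              fix s7 assume s7: "sweep_state n a y f (-1) (-1) s7 \<and> rarr s7 ''gamma'' = g'"
              show "halts sweep s7 (48 * n + 8) ?Q"
              proof (rule halts_mono[OF halts_sweep[OF perm mono conjunct1[OF s7] conjunct2[OF s7]]])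
                fix s8 assume s8: "sweep_state n a y f (-1) (-1) s8 \<and>
                  (\<forall>u<n. rarr s8 ''gamma'' u = g' u + -1 * sweep_val n a y (-1) u)"
                then show "?Q s8"
                  using s4 s6 unfolding half_sum_clip_eq
                  by (auto simp: g_def g'_def Y_def diff_divide_distrib)
              qed simp
            qed simp
          qed simp
        qed simp
      qed simp
    qed simp
  qed simp
qed simp

section \<open>Running times\<close>

lemma label_sum:
  assumes "roc_data n p x y \<mu>"
  shows "(\<Sum>l<n. h l) = (\<Sum>l\<in>pos_set y. h l) + (\<Sum>l\<in>neg_set y. h l)"
proof -
  have "{..<n} = pos_set y \<union> neg_set y"
    using assms by (auto simp: roc_data_def pos_set_def neg_set_def)
  moreover have "pos_set y \<inter> neg_set y = {}" by (auto simp: pos_set_def neg_set_def)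
  ultimately show ?thesis by (simp add: sum.union_disjoint)
qed

lemma label_eq: "l \<in> pos_set y \<Longrightarrow> y $ l = 1" "l \<in> neg_set y \<Longrightarrow> y $ l = -1"
  by (simp_all add: pos_set_def neg_set_def)

text \<open>Within the class of \<open>k\<close> the label factor is 0, across classes it is 2 or
  -2. For negative \<open>k\<close> the minus sign is absorbed by oddness of \<open>clip\<close>,
  which reverses the difference as \<open>beta_star\<close> requires.\<close>

lemma roc_gamma_eq_sum_clip:
  assumes d: "roc_data n p x y \<mu>" and k: "k < n"
  shows "roc_gamma x y \<mu> w k
    = (\<Sum>l<n. (y $ k - y $ l) * clip (a_val x y \<mu> w k - a_val x y \<mu> w l)) / 2"
proof (cases "k \<in> pos_set y")
  case True
  then show ?thesis
    by (simp add: roc_gamma_def label_sum[OF d] label_eq beta_star_eq_clip sum_distrib_left[symmetric])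
next
  case False
  then have "k \<in> neg_set y" using d k by (auto simp: roc_data_def pos_set_def neg_set_def)
  moreover have "clip (a_val x y \<mu> w i - a_val x y \<mu> w k) = - clip (a_val x y \<mu> w k - a_val x y \<mu> w i)" for i
    using clip_minus[of "a_val x y \<mu> w k - a_val x y \<mu> w i"] by simp
  ultimately show ?thesis using False
    by (simp add: roc_gamma_def label_sum[OF d] label_eq beta_star_eq_clip sum_negf
        sum_distrib_left[symmetric])
qed

text \<open>With Y the sum of the labels, the classes have (n + Y) / 2 and (n - Y) / 2 elements. So
  a single pass over the labels suffices to obtain the normalising constant.\<close>

lemma npairs_eq:
  assumes d: "roc_data n p x y \<mu>"
  shows "real (npairs y) = (real n + (\<Sum>i<n. y $ i)) * (real n - (\<Sum>i<n. y $ i)) / 4"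
proof -
  have "real n = real (card (pos_set y)) + real (card (neg_set y))"
    using label_sum[OF d, of "\<lambda>_. 1 :: real"] by simp
  moreover have "(\<Sum>i<n. y $ i) = real (card (pos_set y)) - real (card (neg_set y))"
    using label_sum[OF d, of "\<lambda>i. y $ i"] by (simp add: label_eq)
  ultimately show ?thesis by (simp add: npairs_def)
qed

text \<open>The label supplies the sign that separates the two classes, so the inner loop of the
  gradient program has no branch.\<close>

lemma roc_grad_eq_label_sum:
  assumes d: "roc_data n p x y \<mu>" and k: "k < p"
  shows "roc_grad p x y \<mu> w $ k
    = (\<Sum>i<n. y $ i * roc_gamma x y \<mu> w i * x i $ k) / real (npairs y)"
  using k by (simp add: roc_grad_def label_sum[OF d] label_eq sum_negf)

text \<open>Guarantees \<open>log 2 (real n) \<ge> 1\<close>, without which constant and linear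
  costs could not be absorbed into n log n.\<close>

lemma roc_data_two_le:
  assumes d: "roc_data n p x y \<mu>"
  shows "n \<ge> 2"
proof -
  have "n = card (pos_set y) + card (neg_set y)"
    using label_sum[OF d, of "\<lambda>_. 1 :: nat"] by simp
  moreover have "card (pos_set y) > 0" "card (neg_set y) > 0"
    using d by (auto simp: roc_data_def card_gt_0_iff)
  ultimately show ?thesis by linarith
qed

text \<open>From log n >= 1 the rounded-up logarithm \<open>L\<close> is at most 2 log n, and n >= 2
  gives 45n + 9 <= 50n and 114n + 42 <= 135n. The total is at most 100 + 135 times n log n, hence
  below 300.\<close>

lemma gamma_time_bound:
  fixes n :: nat
  assumes n: "n \<ge> 2"
  obtains L where "n \<le> 2 ^ L" "real ((45 * n + 9) * L + 114 * n + 42) \<le> 300 * (real n * log 2 (real n))"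
proof -
  define L where "L = nat \<lceil>log 2 (real n)\<rceil>"
  have lg: "log 2 (real n) \<ge> 1" using n by simp
  have "real n = 2 powr log 2 (real n)" using n by simp
  also have "\<dots> \<le> 2 powr real L" unfolding L_def by (intro powr_mono) linarith+
  also have "\<dots> = real (2 ^ L)" by (simp add: powr_realpow)
  finally have pow: "n \<le> 2 ^ L" by (simp only: of_nat_le_iff)
  have L: "real L \<le> 2 * log 2 (real n)" using lg unfolding L_def by linarith
  have "(45 * real n + 9) * real L \<le> (50 * real n) * (2 * log 2 (real n))"
    using L n by (intro mult_mono) auto
  moreover have "real n \<le> real n * log 2 (real n)" using lg n by simp
  moreover have "114 * real n + 42 \<le> 135 * real n" using n by simp
  ultimately have "(45 * real n + 9) * real L + 114 * real n + 42 \<le> 300 * (real n * log 2 (real n))"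
    by linarith
  then show thesis using that[OF pow] by simp
qed

lemma gamma_prog_correct:
  assumes d: "roc_data n p x y \<mu>" and inp: "gamma_input n y (a_val x y \<mu> w) s"
  shows "halts_within gamma_prog s (300 * (real n * log 2 (real n)))
    (\<lambda>s'. \<forall>k<n. rarr s' ''gamma'' k = roc_gamma x y \<mu> w k)"
proof -
  from gamma_time_bound[OF roc_data_two_le[OF d]] obtain L
    where L: "n \<le> 2 ^ L" "real ((45 * n + 9) * L + 114 * n + 42) \<le> 300 * (real n * log 2 (real n))" .
  have in': "ireg s ''n'' = n" "\<And>i. i < n \<Longrightarrow> rarr s ''y'' i = y $ i"
      "\<And>i. i < n \<Longrightarrow> rarr s ''a'' i = a_val x y \<mu> w i"
    using inp by (auto simp: gamma_input_def)
  obtain t s' where run: "exec gamma_prog s t s'" "real t \<le> real ((45 * n + 9) * L + 114 * n + 42)"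
    and res: "\<forall>u<n. rarr s' ''gamma'' u = (\<Sum>l<n. (rarr s ''y'' u - rarr s ''y'' l) *
       clip (rarr s ''a'' u - rarr s ''a'' l)) / 2"
    using halts_gamma_prog[OF in'(1) L(1)] unfolding halts_within_def by blast
  have "rarr s' ''gamma'' k = roc_gamma x y \<mu> w k" if "k < n" for k
    using res that in' by (simp add: roc_gamma_eq_sum_clip[OF d that])
  then show ?thesis
    unfolding halts_within_def using run L(2) by (meson order_trans)
qed

section \<open>The gradient from the values gamma\<close>

definition grad_inner_body :: com where
  "grad_inner_body = instrs [RLoad ''t'' ''y'' ''i'', RLoad ''z'' ''gamma'' ''i'', RMul ''t'' ''t'' ''z'',
     RLoad ''z'' ''x'' ''b'', RMul ''t'' ''t'' ''z'', RAdd ''acc'' ''acc'' ''t'',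
     IAdd ''b'' ''b'' ''p'', IAdd ''i'' ''i'' ''one'']"

definition grad_body :: com where
  "grad_body = instrs [IMove ''b'' ''k'', IConst ''i'' 0, RConst ''acc'' 0] ;;
     While (ILess ''i'' ''n'') grad_inner_body ;;
     instrs [RDiv ''acc'' ''acc'' ''m'', RStore ''grad'' ''k'' ''acc'', IAdd ''k'' ''k'' ''one'']"

definition grad_prog :: com where
  "grad_prog = count_labels ;;
     instrs [RAdd ''x'' ''cnt'' ''Y'', RSub ''z'' ''cnt'' ''Y'', RMul ''m'' ''x'' ''z'', RConst ''t'' 4,
       RDiv ''m'' ''m'' ''t'', IConst ''k'' 0] ;;
     While (ILess ''k'' ''p'') grad_body"

definition grad_state :: "nat \<Rightarrow> nat \<Rightarrow> (nat \<Rightarrow> real) \<Rightarrow> (nat \<Rightarrow> real) \<Rightarrow> (nat \<Rightarrow> real) \<Rightarrow> real \<Rightarrow>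
    ram_state \<Rightarrow> bool" where
  "grad_state n p X y g m s \<longleftrightarrow> ireg s ''n'' = n \<and> ireg s ''p'' = p \<and> ireg s ''one'' = 1 \<and>
     rarr s ''x'' = X \<and> rarr s ''y'' = y \<and> rarr s ''gamma'' = g \<and> rreg s ''m'' = m"

text \<open>Indices cannot be multiplied, so the address \<open>i * p + k\<close> is maintained in
  \<open>b\<close> by adding \<open>p\<close> once per row; the invariant ties \<open>b\<close> to
  \<open>i\<close>.\<close>

lemma halts_grad_inner:
  assumes st: "grad_state n p X y g m s" "ireg s ''k'' = k" "ireg s ''b'' = k" "ireg s ''i'' = 0"
      "rreg s ''acc'' = 0" "rarr s ''grad'' = G"
  shows "halts (While (ILess ''i'' ''n'') grad_inner_body) s (10 * n + 1)
    (\<lambda>s'. grad_state n p X y g m s' \<and> ireg s' ''k'' = k \<and> rarr s' ''grad'' = G \<and>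
      rreg s' ''acc'' = (\<Sum>i<n. y i * g i * X (i * p + k)))"
proof (rule halts_While[where V = "\<lambda>s. 10 * (n - ireg s ''i'')" and T = "\<lambda>_. 9" and
    I = "\<lambda>s. grad_state n p X y g m s \<and> ireg s ''k'' = k \<and> rarr s ''grad'' = G \<and> ireg s ''i'' \<le> n \<and>
      ireg s ''b'' = ireg s ''i'' * p + k \<and>
      rreg s ''acc'' = (\<Sum>i<ireg s ''i''. y i * g i * X (i * p + k))"])
  fix s assume "grad_state n p X y g m s \<and> ireg s ''k'' = k \<and> rarr s ''grad'' = G \<and> ireg s ''i'' \<le> n \<and>
      ireg s ''b'' = ireg s ''i'' * p + k \<and>
      rreg s ''acc'' = (\<Sum>i<ireg s ''i''. y i * g i * X (i * p + k))"
    and "eval_test (ILess ''i'' ''n'') s"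
  then show "halts grad_inner_body s 9
     (\<lambda>s'. (grad_state n p X y g m s' \<and> ireg s' ''k'' = k \<and> rarr s' ''grad'' = G \<and> ireg s' ''i'' \<le> n \<and>
      ireg s' ''b'' = ireg s' ''i'' * p + k \<and>
      rreg s' ''acc'' = (\<Sum>i<ireg s' ''i''. y i * g i * X (i * p + k))) \<and>
      10 * (n - ireg s' ''i'') + 9 + 1 \<le> 10 * (n - ireg s ''i''))"
    unfolding grad_inner_body_def by (intro halts_loop_free) (auto simp: grad_state_def)
next
  fix s assume I: "grad_state n p X y g m s \<and> ireg s ''k'' = k \<and> rarr s ''grad'' = G \<and> ireg s ''i'' \<le> n \<and>
      ireg s ''b'' = ireg s ''i'' * p + k \<and>
      rreg s ''acc'' = (\<Sum>i<ireg s ''i''. y i * g i * X (i * p + k))"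
    and "\<not> eval_test (ILess ''i'' ''n'') s"
  then have "ireg s ''i'' = n" by (simp add: grad_state_def)
  with I show "grad_state n p X y g m s \<and> ireg s ''k'' = k \<and> rarr s ''grad'' = G \<and>
      rreg s ''acc'' = (\<Sum>i<n. y i * g i * X (i * p + k))" by simp
qed (use st in auto)

lemma halts_grad_loop:
  assumes st: "grad_state n p X y g m s" "ireg s ''k'' = 0"
  shows "halts (While (ILess ''k'' ''p'') grad_body) s ((10 * n + 10) * p + 1)
    (\<lambda>s'. \<forall>k<p. rarr s' ''grad'' k = (\<Sum>i<n. y i * g i * X (i * p + k)) / m)"
proof -
  let ?r = "\<lambda>k. (\<Sum>i<n. y i * g i * X (i * p + k)) / m"
  let ?I = "\<lambda>s. grad_state n p X y g m s \<and> (\<forall>k<ireg s ''k''. rarr s ''grad'' k = ?r k)"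
  show ?thesis
  proof (rule halts_While[where I = ?I and T = "\<lambda>_. 10 * n + 9" and
        V = "\<lambda>s. (10 * n + 10) * (p - ireg s ''k'')"])
    show "?I s" using st by simp
    fix s assume I: "?I s"
    {
      assume "eval_test (ILess ''k'' ''p'') s"
      then have kp: "ireg s ''k'' < p" using I by (simp add: grad_state_def)
      define k G where ds: "k = ireg s ''k''" "G = rarr s ''grad''"
      have V: "(10 * n + 10) * (p - Suc k) + (10 * n + 9) + 1 \<le> (10 * n + 10) * (p - k)"
      proof -
        have "p - k = Suc (p - Suc k)" using kp by (simp add: ds)
        then show ?thesis by simp
      qed
      show "halts grad_body s (10 * n + 9) (\<lambda>s'. ?I s' \<and>
          (10 * n + 10) * (p - ireg s' ''k'') + (10 * n + 9) + 1 \<le> (10 * n + 10) * (p - ireg s ''k''))"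
        unfolding grad_body_def
      proof (rule halts_Seq[where ?T1.0 = 4 and ?T2.0 = "10 * n + 5" and
            R = "\<lambda>s. grad_state n p X y g m s \<and> ireg s ''k'' = k \<and> ireg s ''b'' = k \<and> ireg s ''i'' = 0 \<and>
              rreg s ''acc'' = 0 \<and> rarr s ''grad'' = G"])
        show "halts (instrs [IMove ''b'' ''k'', IConst ''i'' 0, RConst ''acc'' 0]) s 4
          (\<lambda>s. grad_state n p X y g m s \<and> ireg s ''k'' = k \<and> ireg s ''b'' = k \<and> ireg s ''i'' = 0 \<and>
              rreg s ''acc'' = 0 \<and> rarr s ''grad'' = G)"
          using I by (intro halts_loop_free) (auto simp: grad_state_def ds)
        fix s1 assume s1: "grad_state n p X y g m s1 \<and> ireg s1 ''k'' = k \<and> ireg s1 ''b'' = k \<and>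
            ireg s1 ''i'' = 0 \<and> rreg s1 ''acc'' = 0 \<and> rarr s1 ''grad'' = G"
        show "halts (While (ILess ''i'' ''n'') grad_inner_body ;;
           instrs [RDiv ''acc'' ''acc'' ''m'', RStore ''grad'' ''k'' ''acc'', IAdd ''k'' ''k'' ''one''])
           s1 (10 * n + 5) (\<lambda>s'. ?I s' \<and>
          (10 * n + 10) * (p - ireg s' ''k'') + (10 * n + 9) + 1 \<le> (10 * n + 10) * (p - ireg s ''k''))"
        proof (rule halts_Seq[OF halts_grad_inner, where ?T2.0 = 4])
          fix s2 assume s2: "grad_state n p X y g m s2 \<and> ireg s2 ''k'' = k \<and> rarr s2 ''grad'' = G \<and>
            rreg s2 ''acc'' = (\<Sum>i<n. y i * g i * X (i * p + k))"
          show "halts (instrs [RDiv ''acc'' ''acc'' ''m'', RStore ''grad'' ''k'' ''acc'', IAdd ''k'' ''k'' ''one''])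
             s2 4 (\<lambda>s'. ?I s' \<and>
             (10 * n + 10) * (p - ireg s' ''k'') + (10 * n + 9) + 1 \<le> (10 * n + 10) * (p - ireg s ''k''))"
            using s2 I V by (intro halts_loop_free) (auto simp: grad_state_def ds less_Suc_eq)
        qed (use s1 in auto)
      qed simp
    }
    assume "\<not> eval_test (ILess ''k'' ''p'') s"
    then show "\<forall>k<p. rarr s ''grad'' k = ?r k" using I by (simp add: grad_state_def)
  qed (use st in simp)
qed

lemma halts_grad_prog:
  assumes "ireg s ''n'' = n" "ireg s ''p'' = p"
  defines "y \<equiv> rarr s ''y''"
  shows "halts grad_prog s ((10 * n + 10) * p + 6 * n + 16) (\<lambda>s'. \<forall>k<p. rarr s' ''grad'' k =
     (\<Sum>i<n. y i * rarr s ''gamma'' i * rarr s ''x'' (i * p + k)) /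
     ((real n + (\<Sum>i<n. y i)) * (real n - (\<Sum>i<n. y i)) / 4))" (is "halts _ _ _ ?Q")
  unfolding grad_prog_def
proof (rule halts_Seq[OF halts_count_labels[OF assms(1), folded y_def], where ?T2.0 = "(10 * n + 10) * p + 8"])
  fix s1 assume s1: "env n (rarr s ''a'') y s1 \<and> ireg s1 ''p'' = ireg s ''p'' \<and> iarr s1 = iarr s \<and>
    rarr s1 = rarr s \<and> rreg s1 ''Y'' = (\<Sum>i<n. y i) \<and> rreg s1 ''cnt'' = real n"
  define m where "m = (real n + (\<Sum>i<n. y i)) * (real n - (\<Sum>i<n. y i)) / 4"
  let ?st = "\<lambda>s'. grad_state n p (rarr s ''x'') y (rarr s ''gamma'') m s' \<and> ireg s' ''k'' = 0"
  show "halts (instrs [RAdd ''x'' ''cnt'' ''Y'', RSub ''z'' ''cnt'' ''Y'', RMul ''m'' ''x'' ''z'', RConst ''t'' 4,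
       RDiv ''m'' ''m'' ''t'', IConst ''k'' 0] ;; While (ILess ''k'' ''p'') grad_body) s1 ((10 * n + 10) * p + 8) ?Q"
  proof (rule halts_Seq[where R = ?st and ?T1.0 = 7])
    show "halts (instrs [RAdd ''x'' ''cnt'' ''Y'', RSub ''z'' ''cnt'' ''Y'', RMul ''m'' ''x'' ''z'', RConst ''t'' 4,
       RDiv ''m'' ''m'' ''t'', IConst ''k'' 0]) s1 7 ?st"
      using s1 assms(2) by (intro halts_loop_free) (auto simp: env_def grad_state_def m_def)
    fix s2 assume "?st s2"
    then show "halts (While (ILess ''k'' ''p'') grad_body) s2 ((10 * n + 10) * p + 1) ?Q"
      unfolding m_def[symmetric] by (intro halts_grad_loop) auto
  qed simp
qed simp

lemma grad_prog_correct:
  assumes d: "roc_data n p x y \<mu>" and p: "p \<ge> 1"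
    and inp: "grad_input n p x y (roc_gamma x y \<mu> w) s"
  shows "halts_within grad_prog s (42 * (real n * real p))
    (\<lambda>s'. \<forall>k<p. rarr s' ''grad'' k = roc_grad p x y \<mu> w $ k)"
proof -
  have n: "n \<ge> 2" by (rule roc_data_two_le[OF d])
  have in': "ireg s ''n'' = n" "ireg s ''p'' = p" "\<And>i. i < n \<Longrightarrow> rarr s ''y'' i = y $ i"
      "\<And>i k. i < n \<Longrightarrow> k < p \<Longrightarrow> rarr s ''x'' (i * p + k) = x i $ k"
      "\<And>i. i < n \<Longrightarrow> rarr s ''gamma'' i = roc_gamma x y \<mu> w i"
    using inp by (auto simp: grad_input_def)
  have Y: "(\<Sum>i<n. rarr s ''y'' i) = (\<Sum>i<n. y $ i)" by (intro sum.cong) (auto simp: in')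
  \<comment> \<open>The constant is 42 = 10 + 10 + 6 + 16: each of p, n and 1 is at most
    \<open>n * p\<close>.\<close>
  have "p \<le> n * p" "n \<le> n * p" using n p by simp_all
  moreover have "(10 * n + 10) * p = 10 * (n * p) + 10 * p" by (simp add: algebra_simps)
  ultimately have "(10 * n + 10) * p + 6 * n + 16 \<le> 42 * (n * p)" using n by linarith
  then have "halts grad_prog s (42 * (n * p)) (\<lambda>s'. \<forall>k<p. rarr s' ''grad'' k = roc_grad p x y \<mu> w $ k)"
    by (rule halts_mono[OF halts_grad_prog[OF in'(1,2)]])
      (simp add: Y in' roc_grad_eq_label_sum[OF d] npairs_eq[OF d])
  then show ?thesis by simp
qed

theorem mainTheorem5:
  shows
    "(\<forall>n p x y \<mu> w. roc_data n p x y \<mu> \<and> w \<in> carrier_vec p \<longrightarrow>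
        has_gradient p (roc_risk x y \<mu>) (roc_grad p x y \<mu> w) w) \<and>
     (\<exists>prog (C::real). \<forall>n p x y \<mu> w s.
        roc_data n p x y \<mu> \<and> w \<in> carrier_vec p \<and> gamma_input n y (a_val x y \<mu> w) s \<longrightarrow>
        halts_within prog s (C * (real n * log 2 (real n)))
          (\<lambda>s'. \<forall>k<n. rarr s' ''gamma'' k = roc_gamma x y \<mu> w k)) \<and>
     (\<exists>prog (C::real). \<forall>n p x y \<mu> w s.
        roc_data n p x y \<mu> \<and> w \<in> carrier_vec p \<and> p \<ge> 1 \<and>
        grad_input n p x y (roc_gamma x y \<mu> w) s \<longrightarrow>
        halts_within prog s (C * (real n * real p))
          (\<lambda>s'. \<forall>k<p. rarr s' ''grad'' k = roc_grad p x y \<mu> w $ k))"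
proof (intro conjI)
  show "\<forall>n p x y \<mu> w. roc_data n p x y \<mu> \<and> w \<in> carrier_vec p \<longrightarrow>
        has_gradient p (roc_risk x y \<mu>) (roc_grad p x y \<mu> w) w"
    using roc_risk_has_gradient by blast
  show "\<exists>prog (C::real). \<forall>n p x y \<mu> w s.
        roc_data n p x y \<mu> \<and> w \<in> carrier_vec p \<and> gamma_input n y (a_val x y \<mu> w) s \<longrightarrow>
        halts_within prog s (C * (real n * log 2 (real n)))
          (\<lambda>s'. \<forall>k<n. rarr s' ''gamma'' k = roc_gamma x y \<mu> w k)"
    by (rule exI[of _ gamma_prog], rule exI[of _ 300]) (blast intro: gamma_prog_correct)
  show "\<exists>prog (C::real). \<forall>n p x y \<mu> w s.
        roc_data n p x y \<mu> \<and> w \<in> carrier_vec p \<and> p \<ge> 1 \<and>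
        grad_input n p x y (roc_gamma x y \<mu> w) s \<longrightarrow>
        halts_within prog s (C * (real n * real p))
          (\<lambda>s'. \<forall>k<p. rarr s' ''grad'' k = roc_grad p x y \<mu> w $ k)"
    by (rule exI[of _ grad_prog], rule exI[of _ 42]) (blast intro: grad_prog_correct)
qed

end
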